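(* Let $y\in W_2^1(\mathcal T_\tau)$. Then $y$ is a solution of the variational problem (VP) if and only if $y\in W_2^2(\widetilde{\mathcal T})$ and $y$ is a solution of the boundary value problem $\mathcal B$.
   Context: Tree setup. Fix integers $m\ge 1$ and $0\le d<m$. Let $\mathcal T$ be a compact rooted tree with vertices $v_0,v_1,\dots,v_m$ and edges $e_1,\dots,e_m$. Here $e_j=[v_{k_j},v_j]$, with $k_1=0$ and $k_j\in\{1,\dots,d\}$ for $j=2,\dots,m$. The map $j\mapsto k_j$ is such that iterating it from any $j$ eventually reaches $1$ and then $0$, so the graph is a tree. The vertices $v_0,v_{d+1},\dots,v_m$ are the boundary vertices (each incident to exactly one edge). The vertices $v_1,\dots,v_d$ are internal. The root is $v_0$. For $j=0,\dots,d$ put $V_j:=\{\nu\in\{1,\dots,m\}: k_\nu=j\}$, the indices of the edges emanating from $v_j$. Thus $V_0=\{1\}$, and $V_j\neq\emptyset$ for $j=1,\dots,d$. Lengths and delay. Edge $e_j$ has length $T_j>0$ and is parametrized by $t\in[0,T_j]$, with $t=0$ at $v_{k_j}$ and $t=T_j$ at $v_j$. Fix $\tau\ge0$ with $\tau<T_j$ for all $j$. Set $l_j:=T_j$ for $j=1,\dots,d$ and $l_j:=T_j-\tau$ for $j=d+1,\dots,m$. Functions and spaces. A function on $\mathcal T_\tau$ is a tuple $y=[y_1,\dots,y_m]$ of real functions with $y_1$ defined on $[-\tau,T_1]$ and $y_j$ defined on $[0,T_j]$ for $j\ge2$. We use the following Sobolev spaces: - $W_2^k(\mathcal T_\tau):=W_2^k[-\tau,T_1]\oplus\bigoplus_{j=2}^mW_2^k[0,T_j]$;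 - $W_2^k(\mathcal T):=\bigoplus_{j=1}^mW_2^k[0,T_j]$; - $L_2(\mathcal T):=\bigoplus_{j=1}^m L_2(0,T_j)$. Each carries the sum of the componentwise norms squared. We write $y\in W_2^2(\widetilde{\mathcal T})$ if $y_j|_{[0,l_j]}\in W_2^2[0,l_j]$ for every $j$. Operators. Fix real constants $b_j,c_j$ for $j=1,\dots,m$. Define $$\ell_jy(t):=y_j'(t)+b_jy_j(t)+c_jy_j(t-\tau),\qquad 0<t<T_j,$$ with the following convention (the global-delay condition): for $j\ge2$ and $t\in(0,\tau)$, the value $y_j(t-\tau)$ means $y_{k_j}(t-\tau+T_{k_j})$. For $j=1$, the value $y_1(t-\tau)$ uses $y_1$ on $[-\tau,0]$. Write $\ell y:=[\ell_1y,\dots,\ell_my]$ and $$\mathcal J(y):=\sum_{j=1}^m\int_0^{T_j}(\ell_jy(t))^2\,dt,\qquad B(y,v):=\sum_{j=1}^m\int_0^{T_j}\ell_jy(t)\,\ell_jv(t)\,dt.$$ Conditions. Let $\varphi\in W_2^1[-\tau,0]$ be a given real function. - (C) continuity: $y_j(0)=y_{k_j}(T_{k_j})$ for $j=2,\dots,m$. - (I) prehistory: $y_1(t)=\varphi(t)$ for $t\in[-\tau,0]$. - (Z) target: $y_j(t)=0$ for $t\in[T_j-\tau,T_j]$, $j=d+1,\dots,m$. Variational problem (VP): find $y\in W_2^1(\mathcal T_\tau)$ satisfying (C), (I), (Z) such that $\mathcal J(y)\le\mathcal J(z)$ for every $z\in W_2^1(\mathcal T_\tau)$ satisfying (C), (I),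 (Z). Boundary value problem $\mathcal B$. Define, for the appropriate $t$, $$\tilde\ell_jy(t):=\begin{cases} c_j\,\ell_jy(t+\tau), & 0<t<T_j-\tau,\ j=1,\dots,m,\\ \sum_{\nu\in V_j}c_\nu\,\ell_\nu y(t+\tau-T_j), & T_j-\tau<t<T_j,\ j=1,\dots,d,\end{cases}$$ and $$\mathcal L_jy(t):=-(\ell_jy)'(t)+b_j\ell_jy(t)+\tilde\ell_jy(t).$$ Also set $\beta_j:=b_j-\sum_{\nu\in V_j}b_\nu$ and $\gamma_j:=c_j-\sum_{\nu\in V_j}c_\nu$ for $j=1,\dots,d$. A solution of $\mathcal B$ is a $y\in W_2^1(\mathcal T_\tau)\cap W_2^2(\widetilde{\mathcal T})$ such that: - $y$ satisfies (C), (I), (Z); - $\mathcal L_jy(t)=0$ for a.e. $t\in(0,l_j)$, for each $j=1,\dots,m$; - the Kirchhoff-type conditions hold: $$y_j'(T_j)-\sum_{\nu\in V_j}y_\nu'(0)+\beta_jy_j(T_j)+\gamma_jy_j(T_j-\tau)=0,\qquad j=1,\dots,d.$$ *)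

theory Defs
  imports "HOL-Analysis.Analysis"
begin

definition L2_on :: "real \<Rightarrow> real \<Rightarrow> (real \<Rightarrow> real) \<Rightarrow> bool" where
  "L2_on a b g \<longleftrightarrow> g absolutely_integrable_on {a..b} \<and> (\<lambda>x. (g x)^2) integrable_on {a..b}"

text \<open>W_2^1[a,b]: f is the integral of an L2 function (i.e. absolutely continuous with L2 derivative).\<close>
definition W21_on :: "real \<Rightarrow> real \<Rightarrow> (real \<Rightarrow> real) \<Rightarrow> bool" where
  "W21_on a b f \<longleftrightarrow> a \<le> b \<and>
     (\<exists>g. L2_on a b g \<and> (\<forall>x\<in>{a..b}. f x = f a + integral {a..x} g))"

definition W22_on :: "real \<Rightarrow> real \<Rightarrow> (real \<Rightarrow> real) \<Rightarrow> bool" where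
  "W22_on a b f \<longleftrightarrow> a \<le> b \<and>
     (\<exists>g. W21_on a b g \<and> (\<forall>x\<in>{a..b}. f x = f a + integral {a..x} g))"

text \<open>Parameters: m, d, the parent map k, lengths T, delay tau, coefficients b c, prehistory phi.
  A function on the tree is y :: nat \<Rightarrow> real \<Rightarrow> real, y j being the component on edge e_j.\<close>

definition tree_setup ::
  "nat \<Rightarrow> nat \<Rightarrow> (nat \<Rightarrow> nat) \<Rightarrow> (nat \<Rightarrow> real) \<Rightarrow> real \<Rightarrow> bool" where
  "tree_setup m d k T \<tau> \<longleftrightarrow>
     1 \<le> m \<and> d < m \<and> k 1 = 0 \<and>
     (\<forall>j\<in>{2..m}. k j \<in> {1..d}) \<and>
     (\<forall>j\<in>{1..m}. \<exists>n. (k ^^ n) j = 1) \<and>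
     (\<forall>j\<in>{1..d}. {\<nu>\<in>{1..m}. k \<nu> = j} \<noteq> {}) \<and>
     (\<forall>j\<in>{1..m}. 0 < T j) \<and> 0 \<le> \<tau> \<and> (\<forall>j\<in>{1..m}. \<tau> < T j)"

text \<open>V_j: indices of the edges emanating from v_j.\<close>
definition Vset :: "nat \<Rightarrow> (nat \<Rightarrow> nat) \<Rightarrow> nat \<Rightarrow> nat set" where
  "Vset m k j = {\<nu>\<in>{1..m}. k \<nu> = j}"

definition lens :: "nat \<Rightarrow> (nat \<Rightarrow> real) \<Rightarrow> real \<Rightarrow> nat \<Rightarrow> real" where
  "lens d T \<tau> j = (if j \<le> d then T j else T j - \<tau>)"

definition in_W21_Ttau :: "nat \<Rightarrow> (nat \<Rightarrow> real) \<Rightarrow> real \<Rightarrow> (nat \<Rightarrow> real \<Rightarrow> real) \<Rightarrow> bool" where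
  "in_W21_Ttau m T \<tau> y \<longleftrightarrow> W21_on (-\<tau>) (T 1) (y 1) \<and> (\<forall>j\<in>{2..m}. W21_on 0 (T j) (y j))"

definition in_W22_tilde ::
  "nat \<Rightarrow> nat \<Rightarrow> (nat \<Rightarrow> real) \<Rightarrow> real \<Rightarrow> (nat \<Rightarrow> real \<Rightarrow> real) \<Rightarrow> bool" where
  "in_W22_tilde m d T \<tau> y \<longleftrightarrow> (\<forall>j\<in>{1..m}. W22_on 0 (lens d T \<tau> j) (y j))"

definition cond_C :: "nat \<Rightarrow> (nat \<Rightarrow> nat) \<Rightarrow> (nat \<Rightarrow> real) \<Rightarrow> (nat \<Rightarrow> real \<Rightarrow> real) \<Rightarrow> bool" where
  "cond_C m k T y \<longleftrightarrow> (\<forall>j\<in>{2..m}. y j 0 = y (k j) (T (k j)))"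

definition cond_I :: "real \<Rightarrow> (real \<Rightarrow> real) \<Rightarrow> (nat \<Rightarrow> real \<Rightarrow> real) \<Rightarrow> bool" where
  "cond_I \<tau> \<phi> y \<longleftrightarrow> (\<forall>t\<in>{-\<tau>..0}. y 1 t = \<phi> t)"

definition cond_Z ::
  "nat \<Rightarrow> nat \<Rightarrow> (nat \<Rightarrow> real) \<Rightarrow> real \<Rightarrow> (nat \<Rightarrow> real \<Rightarrow> real) \<Rightarrow> bool" where
  "cond_Z m d T \<tau> y \<longleftrightarrow> (\<forall>j\<in>{d+1..m}. \<forall>t\<in>{T j - \<tau>..T j}. y j t = 0)"

definition admissible ::
  "nat \<Rightarrow> nat \<Rightarrow> (nat \<Rightarrow> nat) \<Rightarrow> (nat \<Rightarrow> real) \<Rightarrow> real \<Rightarrow> (real \<Rightarrow> real)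
     \<Rightarrow> (nat \<Rightarrow> real \<Rightarrow> real) \<Rightarrow> bool" where
  "admissible m d k T \<tau> \<phi> y \<longleftrightarrow>
     in_W21_Ttau m T \<tau> y \<and> cond_C m k T y \<and> cond_I \<tau> \<phi> y \<and> cond_Z m d T \<tau> y"

text \<open>The delayed value y_j(t - tau) with the global-delay convention.\<close>
definition ydel :: "(nat \<Rightarrow> nat) \<Rightarrow> (nat \<Rightarrow> real) \<Rightarrow> real \<Rightarrow> (nat \<Rightarrow> real \<Rightarrow> real) \<Rightarrow> nat \<Rightarrow> real \<Rightarrow> real" where
  "ydel k T \<tau> y j t = (if 2 \<le> j \<and> t < \<tau> then y (k j) (t - \<tau> + T (k j)) else y j (t - \<tau>))"

definition ell ::
  "(nat \<Rightarrow> nat) \<Rightarrow> (nat \<Rightarrow> real) \<Rightarrow> real \<Rightarrow> (nat \<Rightarrow> real) \<Rightarrow> (nat \<Rightarrow> real)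
     \<Rightarrow> (nat \<Rightarrow> real \<Rightarrow> real) \<Rightarrow> nat \<Rightarrow> real \<Rightarrow> real" where
  "ell k T \<tau> b c y j t = deriv (y j) t + b j * y j t + c j * ydel k T \<tau> y j t"

definition Jfun ::
  "nat \<Rightarrow> (nat \<Rightarrow> nat) \<Rightarrow> (nat \<Rightarrow> real) \<Rightarrow> real \<Rightarrow> (nat \<Rightarrow> real) \<Rightarrow> (nat \<Rightarrow> real)
     \<Rightarrow> (nat \<Rightarrow> real \<Rightarrow> real) \<Rightarrow> real" where
  "Jfun m k T \<tau> b c y = (\<Sum>j=1..m. integral {0..T j} (\<lambda>t. (ell k T \<tau> b c y j t)^2))"

definition solves_VP ::
  "nat \<Rightarrow> nat \<Rightarrow> (nat \<Rightarrow> nat) \<Rightarrow> (nat \<Rightarrow> real) \<Rightarrow> real \<Rightarrow> (nat \<Rightarrow> real) \<Rightarrow> (nat \<Rightarrow> real)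
     \<Rightarrow> (real \<Rightarrow> real) \<Rightarrow> (nat \<Rightarrow> real \<Rightarrow> real) \<Rightarrow> bool" where
  "solves_VP m d k T \<tau> b c \<phi> y \<longleftrightarrow>
     admissible m d k T \<tau> \<phi> y \<and>
     (\<forall>z. admissible m d k T \<tau> \<phi> z \<longrightarrow> Jfun m k T \<tau> b c y \<le> Jfun m k T \<tau> b c z)"

definition ellt ::
  "nat \<Rightarrow> (nat \<Rightarrow> nat) \<Rightarrow> (nat \<Rightarrow> real) \<Rightarrow> real \<Rightarrow> (nat \<Rightarrow> real) \<Rightarrow> (nat \<Rightarrow> real)
     \<Rightarrow> (nat \<Rightarrow> real \<Rightarrow> real) \<Rightarrow> nat \<Rightarrow> real \<Rightarrow> real" where
  "ellt m k T \<tau> b c y j t =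
     (if t < T j - \<tau> then c j * ell k T \<tau> b c y j (t + \<tau>)
      else (\<Sum>\<nu>\<in>Vset m k j. c \<nu> * ell k T \<tau> b c y \<nu> (t + \<tau> - T j)))"

definition Lop ::
  "nat \<Rightarrow> (nat \<Rightarrow> nat) \<Rightarrow> (nat \<Rightarrow> real) \<Rightarrow> real \<Rightarrow> (nat \<Rightarrow> real) \<Rightarrow> (nat \<Rightarrow> real)
     \<Rightarrow> (nat \<Rightarrow> real \<Rightarrow> real) \<Rightarrow> nat \<Rightarrow> real \<Rightarrow> real" where
  "Lop m k T \<tau> b c y j t =
     - deriv (\<lambda>s. ell k T \<tau> b c y j s) t + b j * ell k T \<tau> b c y j t + ellt m k T \<tau> b c y j t"

text \<open>Solutions of the boundary value problem B.  One-sided derivatives at the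
  endpoints of an edge are taken within the edge.\<close>
definition solves_B ::
  "nat \<Rightarrow> nat \<Rightarrow> (nat \<Rightarrow> nat) \<Rightarrow> (nat \<Rightarrow> real) \<Rightarrow> real \<Rightarrow> (nat \<Rightarrow> real) \<Rightarrow> (nat \<Rightarrow> real)
     \<Rightarrow> (real \<Rightarrow> real) \<Rightarrow> (nat \<Rightarrow> real \<Rightarrow> real) \<Rightarrow> bool" where
  "solves_B m d k T \<tau> b c \<phi> y \<longleftrightarrow>
     admissible m d k T \<tau> \<phi> y \<and> in_W22_tilde m d T \<tau> y \<and>
     (\<forall>j\<in>{1..m}. AE t in lebesgue. t \<in> {0<..<lens d T \<tau> j} \<longrightarrow> Lop m k T \<tau> b c y j t = 0) \<and>
     (\<forall>j\<in>{1..d}.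
        vector_derivative (y j) (at (T j) within {0..T j})
        - (\<Sum>\<nu>\<in>Vset m k j. vector_derivative (y \<nu>) (at 0 within {0..T \<nu>}))
        + (b j - (\<Sum>\<nu>\<in>Vset m k j. b \<nu>)) * y j (T j)
        + (c j - (\<Sum>\<nu>\<in>Vset m k j. c \<nu>)) * y j (T j - \<tau>) = 0)"

end

theory Submission
  imports Defs
begin

text \<open>
  The cost is a quadratic form, so an admissible \<open>y\<close> is a minimiser iff the bilinear form
  \<open>B y v\<close> vanishes for all admissible increments \<open>v\<close> (zero prehistory).  Shifting
  the delayed terms back along the tree turns \<open>B y v\<close> into a sum over edges of
  \<open>\<integral> (w v' + h v)\<close> over \<open>[0, l\<^sub>j]\<close>, with \<open>w = \<ell>\<^sub>j y\<close> and
  \<open>h = b\<^sub>j w\<close> plus the adjoint delay term.  Increments supported on one edge and the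
  du Bois-Reymond lemma show that \<open>w\<close> is absolutely continuous with \<open>w' = h\<close>; this is
  both the \<open>W\<^sub>2\<^sup>2\<close> regularity of \<open>y\<close> and the equation
  \<open>\<L>\<^sub>j y = 0\<close>.  Integrating by parts, \<open>B y v\<close> reduces to vertex terms
  \<open>v\<^sub>j(T\<^sub>j)\<close> times the jump of \<open>w\<close> at \<open>v\<^sub>j\<close>, and the vanishing of these
  jumps is the Kirchhoff condition.  Since the functional is written with the pointwise derivative
  \<open>deriv\<close>, Lebesgue's differentiation theorem on the line is needed; it follows from Henstock's
  lemma and the Vitali covering lemma.
\<close>

section \<open>Differentiation of indefinite integrals\<close>

text \<open>A bad interval contributes more than \<open>\<eta>\<close> times its length to the
  Henstock defect. Vitali's lemma picks disjoint bad intervals whose fivefold enlargements cover the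
  set, and Henstock's lemma bounds their total defect by \<open>e * \<eta> / 5\<close>, so the
  enlargements have measure at most \<open>e\<close>.\<close>

lemma negligible_bad_intervals:
  fixes f :: "real \<Rightarrow> real"
  assumes f: "f integrable_on {a..b}" and \<eta>: "\<eta> > 0"
  shows "negligible {x\<in>{a..b}. \<forall>\<delta>>0. \<exists>u v. a \<le> u \<and> u < v \<and> v \<le> b \<and> x \<in> {u..v} \<and> v - u < \<delta>
            \<and> \<bar>(v - u) * f x - integral {u..v} f\<bar> > \<eta> * (v - u)}" (is "negligible ?E")
  unfolding negligible_outer_le
proof (intro allI impI)
  fix e :: real assume e: "e > 0"
  obtain \<gamma> where \<gamma>: "gauge \<gamma>" and
    hen: "\<And>p. p tagged_partial_division_of (cbox a b) \<Longrightarrow> \<gamma> fine p \<Longrightarrow>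
             (\<Sum>(x,k)\<in>p. norm (measure lborel k *\<^sub>R f x - integral k f)) < e * \<eta> / 5"
    using Henstock_lemma[of f a b "e * \<eta> / 5"] f e \<eta> by auto
  \<comment> \<open>The tag \<open>x\<close> is recorded with the interval, since it may lie
    anywhere in \<open>{u..v}\<close>; \<open>c\<close> and \<open>r\<close> recast the intervals as
    balls for the covering lemma.\<close>
  define K where "K = {(x,u,v). a \<le> u \<and> u < v \<and> v \<le> b \<and> x \<in> {u..v} \<and> {u..v} \<subseteq> \<gamma> x
            \<and> \<bar>(v - u) * f x - integral {u..v} f\<bar> > \<eta> * (v - u)}"
  define c where "c = (\<lambda>(x::real,u::real,v). (u + v) / 2)"
  define r where "r = (\<lambda>(x::real,u::real,v). (v - u) / 2)"
  have cb: "cball (c i) (r i) = (case i of (x,u,v) \<Rightarrow> {u..v})" for i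
  proof (cases i)
    case (fields x u v)
    have "(u + v) / 2 - (v - u) / 2 = u" "(u + v) / 2 + (v - u) / 2 = v" by argo+
    then have "cball ((u + v) / 2) ((v - u) / 2) = {u..v}" by (simp only: cball_eq_atLeastAtMost)
    then show ?thesis by (simp add: fields c_def r_def)
  qed
  have "?E \<subseteq> (\<Union>i\<in>K. cball (c i) (r i))"
  proof
    fix x assume x: "x \<in> ?E"
    obtain \<delta> where \<delta>: "\<delta> > 0" "ball x \<delta> \<subseteq> \<gamma> x"
      using \<gamma> by (metis gauge_def openE)
    obtain u v where uv: "a \<le> u" "u < v" "v \<le> b" "x \<in> {u..v}" "v - u < \<delta>"
        "\<bar>(v - u) * f x - integral {u..v} f\<bar> > \<eta> * (v - u)"
      using x \<delta>(1) by blast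
    have "{u..v} \<subseteq> ball x \<delta>" using uv by (auto simp: dist_real_def)
    then have "(x,u,v) \<in> K" using uv \<delta> by (auto simp: K_def)
    then show "x \<in> (\<Union>i\<in>K. cball (c i) (r i))"
      using uv(4) by (intro UN_I[of "(x,u,v)"]) (auto simp: cb)
  qed
  moreover have "\<And>i. i \<in> K \<Longrightarrow> 0 < r i \<and> r i \<le> (b - a)"
    by (auto simp: K_def r_def)
  ultimately obtain C where C: "countable C" "C \<subseteq> K"
     "pairwise (\<lambda>i j. disjnt (cball (c i) (r i)) (cball (c j) (r j))) C"
     "?E \<subseteq> (\<Union>i\<in>C. cball (c i) (5 * r i))"
    by (rule Vitali_covering_lemma_cballs) (assumption | rule that)+
  \<comment> \<open>Tagged partial divisions are finite, so the bound is shown uniformly for finite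
    \<open>J\<close> and then passes to the countable family \<open>C\<close>.\<close>
  have fin: "measure lebesgue (\<Union>i\<in>J. cball (c i) (5 * r i)) \<le> e" if J: "J \<subseteq> C" "finite J" for J
  proof -
    define g where "g = (\<lambda>(x::real,u::real,v). (x, cbox u v))"
    have JK: "J \<subseteq> K" using J C by auto
    have inj: "inj_on g J"
    proof (rule inj_onI)
      fix i j assume ij: "i \<in> J" "j \<in> J" "g i = g j"
      obtain x u v x' u' v' where "i = (x,u,v)" "j = (x',u',v')" by (metis prod_cases3)
      moreover have "i \<in> K" "j \<in> K" using ij JK by auto
      ultimately show "i = j" using ij by (simp add: g_def K_def Icc_eq_Icc)
    qed
    have int: "interior (snd (g i)) \<inter> interior (snd (g j)) = {}" if "i \<in> J" "j \<in> J" "i \<noteq> j" for i j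
    proof -
      have "disjnt (cball (c i) (r i)) (cball (c j) (r j))"
        using C(3) J that by (meson pairwiseD subsetD)
      then have "snd (g i) \<inter> snd (g j) = {}"
        by (auto simp: cb g_def disjnt_def split: prod.splits)
      then show ?thesis using interior_subset by blast
    qed
    have "g ` J tagged_partial_division_of (cbox a b)"
      unfolding tagged_partial_division_of_def
    proof (intro conjI allI impI)
      show "finite (g ` J)" using J by simp
    next
      fix x1 K1 x2 K2 assume h: "(x1, K1) \<in> g ` J \<and> (x2, K2) \<in> g ` J \<and> (x1, K1) \<noteq> (x2, K2)"
      then obtain i j where ij: "i \<in> J" "j \<in> J" "g i = (x1,K1)" "g j = (x2,K2)" by (metis imageE)
      then have "i \<noteq> j" using h by metis
      then show "interior K1 \<inter> interior K2 = {}" using int[of i j] ij by simp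
    next
      fix x L assume "(x, L) \<in> g ` J"
      then obtain u v where uv: "(x,u,v) \<in> K" "L = {u..v}" using JK by (auto simp: g_def image_iff)
      then show "x \<in> L" "L \<subseteq> cbox a b" "\<exists>a b. L = cbox a b" by (auto simp: K_def)
    qed
    moreover have "\<gamma> fine (g ` J)"
      using JK by (fastforce simp: fine_def g_def K_def image_iff)
    ultimately have "(\<Sum>(x,k)\<in>g ` J. norm (measure lborel k *\<^sub>R f x - integral k f)) < e * \<eta> / 5"
      by (rule hen)
    then have le: "(\<Sum>(x,u,v)\<in>J. \<bar>(v - u) * f x - integral {u..v} f\<bar>) < e * \<eta> / 5"
    proof -
      have "(\<Sum>(x,k)\<in>g ` J. norm (measure lborel k *\<^sub>R f x - integral k f)) = 
         (\<Sum>(x,u,v)\<in>J. \<bar>(v - u) * f x - integral {u..v} f\<bar>)"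
        unfolding sum.reindex[OF inj] using JK
        by (intro sum.cong) (auto simp: g_def K_def)
      then show ?thesis using \<open>_ < e * \<eta> / 5\<close> by simp
    qed
    have "measure lebesgue (\<Union>i\<in>J. cball (c i) (5 * r i)) \<le> (\<Sum>i\<in>J. measure lebesgue (cball (c i) (5 * r i)))"
      by (rule measure_UNION_le) (use J in auto)
    also have "\<dots> = (\<Sum>(x,u,v)\<in>J. 5 * (v - u))"
      using JK by (intro sum.cong) (auto simp: c_def r_def K_def cball_eq_atLeastAtMost field_simps)
    also have "\<dots> \<le> (\<Sum>(x,u,v)\<in>J. 5 / \<eta> * \<bar>(v - u) * f x - integral {u..v} f\<bar>)"
      using JK \<eta> by (intro sum_mono) (auto simp: K_def field_simps)
    also have "\<dots> = 5 / \<eta> * (\<Sum>(x,u,v)\<in>J. \<bar>(v - u) * f x - integral {u..v} f\<bar>)"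
      by (simp add: sum_distrib_left case_prod_unfold)
    also have "\<dots> \<le> 5 / \<eta> * (e * \<eta> / 5)"
      using le \<eta> by (intro mult_left_mono) auto
    also have "\<dots> = e" using \<eta> by simp
    finally show ?thesis .
  qed
  have "(\<Union>i\<in>C. cball (c i) (5 * r i)) \<in> lmeasurable" 
    by (rule fmeasurable_UN_bound[OF C(1) _ fin]) auto
  moreover have "measure lebesgue (\<Union>i\<in>C. cball (c i) (5 * r i)) \<le> e" 
    by (rule measure_UN_bound[OF C(1) _ fin]) auto
  ultimately show "\<exists>T. ?E \<subseteq> T \<and> T \<in> lmeasurable \<and> measure lebesgue T \<le> e" using C(4) by blast
qed

text \<open>The exceptional set lies in the union of the bad sets for \<open>\<eta>\<close> =
  1/(n+1). Off this union, means of \<open>f\<close> over short intervals containing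
  \<open>x\<close> are close to \<open>f x\<close>, and a difference quotient at \<open>x\<close> is
  such a mean, with \<open>x\<close> as an endpoint of the interval.\<close>

lemma negligible_not_derivative_integral:
  fixes f :: "real \<Rightarrow> real"
  assumes f: "f integrable_on {a..b}"
  shows "negligible {x\<in>{a<..<b}. \<not> ((\<lambda>x. integral {a..x} f) has_real_derivative f x) (at x)}"
proof -
  define E where "E \<eta> = {x\<in>{a..b}. \<forall>\<delta>>0. \<exists>u v. a \<le> u \<and> u < v \<and> v \<le> b \<and> x \<in> {u..v} \<and> v - u < \<delta>
            \<and> \<bar>(v - u) * f x - integral {u..v} f\<bar> > \<eta> * (v - u)}" for \<eta>
  have neg: "negligible (\<Union>n. E (inverse (real (Suc n))))"
  proof (rule negligible_countable_Union)
    fix S assume "S \<in> range (\<lambda>n. E (inverse (real (Suc n))))"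
    then obtain n where "S = E (inverse (real (Suc n)))" by blast
    then show "negligible S"
      using negligible_bad_intervals[OF f, of "inverse (real (Suc n))"] by (simp only: E_def) simp
  qed simp
  have "((\<lambda>x. integral {a..x} f) has_real_derivative f x) (at x)"
    if x: "x \<in> {a<..<b}" "x \<notin> (\<Union>n. E (inverse (real (Suc n))))" for x
    unfolding has_field_derivative_iff LIM_eq
  proof (intro allI impI)
    fix r :: real assume "r > 0"
    then obtain n where n: "inverse (real (Suc n)) < r" using reals_Archimedean by blast
    obtain \<delta> where \<delta>: "\<delta> > 0" and bd: "\<And>u v. a \<le> u \<Longrightarrow> u < v \<Longrightarrow> v \<le> b \<Longrightarrow> x \<in> {u..v} \<Longrightarrow> v - u < \<delta> \<Longrightarrow>
        \<bar>(v - u) * f x - integral {u..v} f\<bar> \<le> inverse (real (Suc n)) * (v - u)"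
    proof -
      have "x \<notin> E (inverse (real (Suc n)))" "x \<in> {a..b}" using x by auto
      then have "\<not> (\<forall>\<delta>>0. \<exists>u v. a \<le> u \<and> u < v \<and> v \<le> b \<and> x \<in> {u..v} \<and> v - u < \<delta>
            \<and> \<bar>(v - u) * f x - integral {u..v} f\<bar> > inverse (real (Suc n)) * (v - u))"
        unfolding E_def mem_Collect_eq by blast
      then show ?thesis using that by (metis not_less)
    qed
    have int: "integral {a..v} f - integral {a..u} f = integral {u..v} f" if "a \<le> u" "u < v" "v \<le> b" for u v
      using Henstock_Kurzweil_Integration.integral_combine[of a u v f] integrable_subinterval_real[OF f, of a v] that by auto
    have main: "\<bar>(integral {a..v} f - integral {a..u} f) / (v - u) - f x\<bar> < r"
      if "a \<le> u" "u < v" "v \<le> b" "x \<in> {u..v}" "v - u < \<delta>" for u v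
    proof -
      have "\<bar>(v - u) * f x - integral {u..v} f\<bar> < r * (v - u)"
        using bd[OF that] n that(2) by (smt (verit) mult_strict_right_mono)
      moreover have "(integral {a..v} f - integral {a..u} f) / (v - u) - f x = - ((v - u) * f x - integral {u..v} f) / (v - u)"
        using that int[of u v] by (simp add: field_simps)
      ultimately show ?thesis using that by (simp add: abs_divide field_simps)
    qed
    show "\<exists>s>0. \<forall>y. y \<noteq> x \<and> norm (y - x) < s \<longrightarrow>
       norm ((integral {a..y} f - integral {a..x} f) / (y - x) - f x) < r"
    \<comment> \<open>The bounds \<open>x - a\<close> and \<open>b - x\<close> keep \<open>y\<close>
      inside the interval of integration.\<close>
    proof (intro exI[of _ "min \<delta> (min (x - a) (b - x))"] conjI allI impI)
      fix y assume y: "y \<noteq> x \<and> norm (y - x) < min \<delta> (min (x - a) (b - x))"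
      show "norm ((integral {a..y} f - integral {a..x} f) / (y - x) - f x) < r"
      proof (cases "x < y")
        case True then show ?thesis using main[of x y] y x by auto
      next
        case False
        have "(integral {a..y} f - integral {a..x} f) / (y - x) = (integral {a..x} f - integral {a..y} f) / (x - y)"
          using y by (simp add: divide_simps) (simp add: algebra_simps)
        then show ?thesis using main[of y x] y x False by auto
      qed
    qed (use x \<delta> in auto)
  qed
  then have "{x\<in>{a<..<b}. \<not> ((\<lambda>x. integral {a..x} f) has_real_derivative f x) (at x)} \<subseteq> (\<Union>n. E (inverse (real (Suc n))))"
    by blast
  then show ?thesis using neg negligible_subset by blast
qed

section \<open>Square-integrable functions on an interval\<close>

lemma has_integral_shift_real:
  fixes f :: "real \<Rightarrow> real"
  assumes "(f has_integral i) {a..b}"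
  shows "((\<lambda>x. f (x + c)) has_integral i) {a - c..b - c}"
proof -
  have "(\<lambda>x. x + - c) ` {a..b} = {a - c..b - c}"
    by (simp add: image_add_atLeastAtMost')
  then show ?thesis using has_integral_affinity[of f i a b 1 c] assms by simp
qed

lemma integrable_shift_real:
  fixes f :: "real \<Rightarrow> real"
  shows "f integrable_on {a..b} \<Longrightarrow> (\<lambda>x. f (x + c)) integrable_on {a - c..b - c}"
  using has_integral_shift_real unfolding integrable_on_def by blast

lemma integral_shift_real:
  fixes f :: "real \<Rightarrow> real"
  assumes "f integrable_on {a..b}"
  shows "integral {a - c..b - c} (\<lambda>x. f (x + c)) = integral {a..b} f"
  using has_integral_shift_real[OF integrable_integral[OF assms]] by (rule integral_unique)

lemma L2_on_alt:
  "L2_on a b g \<longleftrightarrow> g integrable_on {a..b} \<and> (\<lambda>x. \<bar>g x\<bar>) integrable_on {a..b} \<and> (\<lambda>x. (g x)\<^sup>2) integrable_on {a..b}"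
  by (auto simp: L2_on_def absolutely_integrable_on_def)

text \<open>On a bounded interval |t| <= 1 + t^2 makes a measurable square-integrable function
  absolutely integrable. Closure under sums then only needs measurability and a dominating function
  for the square.\<close>

lemma L2_on_measurable_iff:
  "L2_on a b g \<longleftrightarrow> g \<in> borel_measurable (lebesgue_on {a..b}) \<and> (\<lambda>x. (g x)\<^sup>2) integrable_on {a..b}"
proof
  assume "L2_on a b g"
  then show "g \<in> borel_measurable (lebesgue_on {a..b}) \<and> (\<lambda>x. (g x)\<^sup>2) integrable_on {a..b}"
    by (auto simp: L2_on_def intro: absolutely_integrable_imp_borel_measurable)
next
  assume g: "g \<in> borel_measurable (lebesgue_on {a..b}) \<and> (\<lambda>x. (g x)\<^sup>2) integrable_on {a..b}"
  have le: "\<bar>t\<bar> \<le> 1 + t\<^sup>2" for t :: real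
  proof -
    have "0 \<le> (\<bar>t\<bar> - 1)\<^sup>2" "0 \<le> t\<^sup>2" by simp_all
    moreover have "(\<bar>t\<bar> - 1)\<^sup>2 = t\<^sup>2 - 2 * \<bar>t\<bar> + 1" by (simp add: power2_diff)
    ultimately show ?thesis by linarith
  qed
  have "g absolutely_integrable_on {a..b}"
  proof (rule measurable_bounded_by_integrable_imp_absolutely_integrable)
    show "(\<lambda>x. 1 + (g x)\<^sup>2) integrable_on {a..b}" using g by (intro integrable_add) auto
  qed (use g le in auto)
  then show "L2_on a b g" using g by (simp add: L2_on_def)
qed

lemma L2_on_spike:
  assumes "L2_on a b f" "negligible N" "\<And>x. x \<in> {a..b} - N \<Longrightarrow> g x = f x"
  shows "L2_on a b g"
  unfolding L2_on_alt
proof (intro conjI)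
  show "g integrable_on {a..b}"
    by (rule integrable_spike[OF _ assms(2), of f]) (use assms(1,3) in \<open>auto simp: L2_on_alt\<close>)
  show "(\<lambda>x. \<bar>g x\<bar>) integrable_on {a..b}"
    by (rule integrable_spike[OF _ assms(2), of "\<lambda>x. \<bar>f x\<bar>"]) (use assms(1,3) in \<open>auto simp: L2_on_alt\<close>)
  show "(\<lambda>x. (g x)\<^sup>2) integrable_on {a..b}"
    by (rule integrable_spike[OF _ assms(2), of "\<lambda>x. (f x)\<^sup>2"]) (use assms(1,3) in \<open>auto simp: L2_on_alt\<close>)
qed

lemma L2_on_cong: "L2_on a b f \<Longrightarrow> (\<And>x. x \<in> {a..b} \<Longrightarrow> g x = f x) \<Longrightarrow> L2_on a b g"
  using L2_on_spike[of a b f "{}" g] by auto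

lemma L2_on_subinterval: "L2_on a b f \<Longrightarrow> a \<le> c \<Longrightarrow> d \<le> b \<Longrightarrow> L2_on c d f"
  unfolding L2_on_alt by (auto intro!: integrable_subinterval_real[of _ a b c d])

lemma L2_on_shift:
  assumes "L2_on a b f" shows "L2_on (a - c) (b - c) (\<lambda>x. f (x + c))"
  using assms integrable_shift_real[of f a b c] integrable_shift_real[of "\<lambda>x. \<bar>f x\<bar>" a b c]
    integrable_shift_real[of "\<lambda>x. (f x)\<^sup>2" a b c]
  unfolding L2_on_alt by simp

lemma L2_on_combine:
  assumes "L2_on a b f" "L2_on b c f" "a \<le> b" "b \<le> c"
  shows "L2_on a c f"
  using assms unfolding L2_on_alt by (auto intro: Henstock_Kurzweil_Integration.integrable_combine[of a b c])

lemma L2_on_cmult: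
  assumes "L2_on a b f" shows "L2_on a b (\<lambda>x. c * f x)"
  using assms unfolding L2_on_alt by (auto simp: power_mult_distrib abs_mult intro!: integrable_on_mult_right)

lemma L2_on_add:
  assumes f: "L2_on a b f" and g: "L2_on a b g"
  shows "L2_on a b (\<lambda>x. f x + g x)"
proof -
  have m: "(\<lambda>x. f x + g x) \<in> borel_measurable (lebesgue_on {a..b})"
    using f g unfolding L2_on_measurable_iff by auto
  have "(\<lambda>x. (f x + g x)\<^sup>2) absolutely_integrable_on {a..b}"
  proof (rule measurable_bounded_by_integrable_imp_absolutely_integrable)
    show "(\<lambda>x. 2 * (f x)\<^sup>2 + 2 * (g x)\<^sup>2) integrable_on {a..b}"
      using f g unfolding L2_on_alt by (auto intro!: integrable_add integrable_on_mult_right)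
    show "norm ((f x + g x)\<^sup>2) \<le> 2 * (f x)\<^sup>2 + 2 * (g x)\<^sup>2" for x
    proof -
      have "(f x + g x)\<^sup>2 + (f x - g x)\<^sup>2 = 2 * (f x)\<^sup>2 + 2 * (g x)\<^sup>2"
        by (simp add: power2_sum power2_diff)
      moreover have "0 \<le> (f x - g x)\<^sup>2" "norm ((f x + g x)\<^sup>2) = (f x + g x)\<^sup>2" by simp_all
      ultimately show ?thesis by linarith
    qed
  qed (use m in auto)
  then show ?thesis using m by (auto simp: L2_on_measurable_iff absolutely_integrable_on_def)
qed

lemma L2_on_0 [simp]: "L2_on a b (\<lambda>x. 0)"
  by (auto simp: L2_on_alt intro: integrable_0)

lemma L2_on_sum: "(\<And>i. i \<in> I \<Longrightarrow> L2_on a b (f i)) \<Longrightarrow> L2_on a b (\<lambda>x. \<Sum>i\<in>I. f i x)"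
  by (induction I rule: infinite_finite_induct) (auto intro: L2_on_add)

lemma L2_on_diff:
  assumes f: "L2_on a b f" and g: "L2_on a b g"
  shows "L2_on a b (\<lambda>x. f x - g x)"
  using L2_on_add[OF f L2_on_cmult[OF g, of "-1"]] by simp

lemma L2_on_continuous: "continuous_on {a..b} f \<Longrightarrow> L2_on a b f"
  unfolding L2_on_alt by (auto intro!: integrable_continuous_interval continuous_intros)

lemma L2_on_mult:
  assumes f: "L2_on a b f" and g: "L2_on a b g"
  shows "(\<lambda>x. f x * g x) integrable_on {a..b}"
proof -
  have "(\<lambda>x. f x * g x) absolutely_integrable_on {a..b}"
  proof (rule measurable_bounded_by_integrable_imp_absolutely_integrable)
    show "(\<lambda>x. (f x)\<^sup>2 + (g x)\<^sup>2) integrable_on {a..b}"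
      using f g unfolding L2_on_alt by (auto intro!: integrable_add)
    show "norm (f x * g x) \<le> (f x)\<^sup>2 + (g x)\<^sup>2" for x
    proof -
      have "0 \<le> (\<bar>f x\<bar> - \<bar>g x\<bar>)\<^sup>2" "0 \<le> \<bar>f x\<bar> * \<bar>g x\<bar>" by auto
      moreover have "(\<bar>f x\<bar> - \<bar>g x\<bar>)\<^sup>2 = (f x)\<^sup>2 + (g x)\<^sup>2 - 2 * (\<bar>f x\<bar> * \<bar>g x\<bar>)" by (simp add: power2_diff)
      moreover have "norm (f x * g x) = \<bar>f x\<bar> * \<bar>g x\<bar>" by (simp add: abs_mult)
      ultimately show ?thesis by linarith
    qed
    show "(\<lambda>x. f x * g x) \<in> borel_measurable (lebesgue_on {a..b})"
      using f g unfolding L2_on_measurable_iff by auto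
  qed auto
  then show ?thesis by (simp add: absolutely_integrable_on_def)
qed

section \<open>Weak derivatives\<close>

text \<open>Membership in \<open>W21_on\<close> with its witness exposed. The weak derivative
  \<open>g\<close> is determined only up to a null set, so this is a relation and not a function of
  \<open>f\<close>.\<close>

definition wderiv :: "real \<Rightarrow> real \<Rightarrow> (real \<Rightarrow> real) \<Rightarrow> (real \<Rightarrow> real) \<Rightarrow> bool" where
  "wderiv a b f g \<longleftrightarrow> a \<le> b \<and> L2_on a b g \<and> (\<forall>x\<in>{a..b}. f x = f a + integral {a..x} g)"

lemma W21_on_iff_wderiv: "W21_on a b f \<longleftrightarrow> (\<exists>g. wderiv a b f g)"
  by (auto simp: W21_on_def wderiv_def)

lemma wderiv_eq: "wderiv a b f g \<Longrightarrow> x \<in> {a..b} \<Longrightarrow> f x = f a + integral {a..x} g"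
  and wderiv_L2: "wderiv a b f g \<Longrightarrow> L2_on a b g"
  and wderiv_le: "wderiv a b f g \<Longrightarrow> a \<le> b"
  unfolding wderiv_def by blast+

lemma wderiv_has_integral:
  assumes "wderiv a b f g" "a \<le> u" "u \<le> v" "v \<le> b"
  shows "(g has_integral f v - f u) {u..v}"
proof -
  have g: "g integrable_on {a..b}" using assms(1) by (auto dest: wderiv_L2 simp: L2_on_alt)
  have "integral {a..u} g + integral {u..v} g = integral {a..v} g"
    using assms by (intro Henstock_Kurzweil_Integration.integral_combine integrable_subinterval_real[OF g]) auto
  moreover have "f u = f a + integral {a..u} g" "f v = f a + integral {a..v} g"
    using assms by (auto intro!: wderiv_eq[OF assms(1)])
  ultimately have "integral {u..v} g = f v - f u" by linarith
  moreover have "g integrable_on {u..v}"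
    using assms by (intro integrable_subinterval_real[OF g]) auto
  ultimately show ?thesis by (metis integrable_integral)
qed

lemma wderivI:
  assumes "a \<le> b" "L2_on a b g" "\<And>x. a \<le> x \<Longrightarrow> x \<le> b \<Longrightarrow> (g has_integral f x - f a) {a..x}"
  shows "wderiv a b f g"
  unfolding wderiv_def
proof (intro conjI ballI)
  fix x assume "x \<in> {a..b}"
  then show "f x = f a + integral {a..x} g"
    using integral_unique[OF assms(3), of x] by simp
qed (use assms in auto)

lemma wderiv_continuous_on:
  assumes "wderiv a b f g" shows "continuous_on {a..b} f"
proof -
  have "g integrable_on {a..b}" using assms by (auto dest: wderiv_L2 simp: L2_on_alt)
  then have "continuous_on {a..b} (\<lambda>x. f a + integral {a..x} g)"
    by (intro continuous_intros indefinite_integral_continuous_1)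
  then show ?thesis
    using wderiv_eq[OF assms] continuous_on_cong[OF refl, of "{a..b}" f "\<lambda>x. f a + integral {a..x} g"] by blast
qed

lemma wderiv_L2_fun: "wderiv a b f g \<Longrightarrow> L2_on a b f"
  by (intro L2_on_continuous wderiv_continuous_on)

lemma wderiv_spike:
  assumes f: "wderiv a b f g" and N: "negligible N" "\<And>x. x \<in> {a..b} - N \<Longrightarrow> h x = g x"
  shows "wderiv a b f h"
proof (rule wderivI)
  show "L2_on a b h" using L2_on_spike[OF wderiv_L2[OF f] N] .
  fix x assume x: "a \<le> x" "x \<le> b"
  show "(h has_integral f x - f a) {a..x}"
    using x by (intro has_integral_spike[OF N(1) _ wderiv_has_integral[OF f]] N(2)) auto
qed (rule wderiv_le[OF f])

lemma wderiv_cong: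
  assumes f: "wderiv a b f g" and N: "\<And>x. x \<in> {a..b} \<Longrightarrow> F x = f x"
  shows "wderiv a b F g"
proof (rule wderivI)
  fix x assume x: "a \<le> x" "x \<le> b"
  then show "(g has_integral F x - F a) {a..x}"
    using wderiv_has_integral[OF f, of a x] by (simp add: N)
qed (use wderiv_le[OF f] wderiv_L2[OF f] in auto)

lemma wderiv_add:
  assumes f: "wderiv a b f f'" and g: "wderiv a b g g'"
  shows "wderiv a b (\<lambda>x. f x + g x) (\<lambda>x. f' x + g' x)"
proof (rule wderivI)
  fix x assume x: "a \<le> x" "x \<le> b"
  have "((\<lambda>x. f' x + g' x) has_integral (f x - f a) + (g x - g a)) {a..x}"
    using x by (intro has_integral_add wderiv_has_integral[OF f] wderiv_has_integral[OF g]) auto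
  then show "((\<lambda>x. f' x + g' x) has_integral f x + g x - (f a + g a)) {a..x}"
    by (simp add: algebra_simps)
qed (auto intro: L2_on_add wderiv_L2[OF f] wderiv_L2[OF g] wderiv_le[OF f])

lemma wderiv_cmult:
  assumes f: "wderiv a b f f'"
  shows "wderiv a b (\<lambda>x. c * f x) (\<lambda>x. c * f' x)"
proof (rule wderivI)
  fix x assume x: "a \<le> x" "x \<le> b"
  have "((\<lambda>x. c * f' x) has_integral c * (f x - f a)) {a..x}"
    using x by (intro has_integral_mult_right wderiv_has_integral[OF f]) auto
  then show "((\<lambda>x. c * f' x) has_integral c * f x - c * f a) {a..x}"
    by (simp add: algebra_simps)
qed (auto intro: L2_on_cmult wderiv_L2[OF f] wderiv_le[OF f])

lemma wderiv_diff:
  assumes f: "wderiv a b f f'" and g: "wderiv a b g g'"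
  shows "wderiv a b (\<lambda>x. f x - g x) (\<lambda>x. f' x - g' x)"
  using wderiv_add[OF f wderiv_cmult[OF g, of "-1"]] by simp

lemma wderiv_subinterval:
  assumes f: "wderiv a b f f'" and "a \<le> c" "c \<le> d" "d \<le> b"
  shows "wderiv c d f f'"
  using assms by (intro wderivI L2_on_subinterval[OF wderiv_L2[OF f]] wderiv_has_integral[OF f]) auto

lemma wderiv_shift:
  assumes f: "wderiv a b f f'"
  shows "wderiv (a - c) (b - c) (\<lambda>x. f (x + c)) (\<lambda>x. f' (x + c))"
proof (rule wderivI)
  fix x assume x: "a - c \<le> x" "x \<le> b - c"
  show "((\<lambda>x. f' (x + c)) has_integral f (x + c) - f (a - c + c)) {a - c..x}"
    using has_integral_shift_real[OF wderiv_has_integral[OF f, of a "x + c"], of c] x by simp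
qed (use wderiv_le[OF f] in \<open>auto intro: L2_on_shift wderiv_L2[OF f]\<close>)

lemma wderiv_combine:
  assumes f: "wderiv a b f f'" and g: "wderiv b c f f'"
  shows "wderiv a c f f'"
proof (rule wderivI)
  show "L2_on a c f'" "a \<le> c"
    using L2_on_combine[OF wderiv_L2[OF f] wderiv_L2[OF g] wderiv_le[OF f] wderiv_le[OF g]]
      wderiv_le[OF f] wderiv_le[OF g] by auto
  fix x assume x: "a \<le> x" "x \<le> c"
  show "(f' has_integral f x - f a) {a..x}"
  proof (cases "x \<le> b")
    case True then show ?thesis using x by (intro wderiv_has_integral[OF f]) auto
  next
    case False
    have "(f' has_integral (f b - f a) + (f x - f b)) {a..x}"
      using False x wderiv_le[OF f]
      by (intro has_integral_combine[of a b x] wderiv_has_integral[OF f] wderiv_has_integral[OF g]) auto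
    then show ?thesis by simp
  qed
qed

lemma wderiv_paste:
  assumes f: "wderiv a b f f'" and g: "wderiv b c g g'" and "f b = g b"
  shows "wderiv a c (\<lambda>x. if x \<le> b then f x else g x) (\<lambda>x. if x \<le> b then f' x else g' x)"
proof (rule wderiv_combine)
  show "wderiv a b (\<lambda>x. if x \<le> b then f x else g x) (\<lambda>x. if x \<le> b then f' x else g' x)"
    by (rule wderiv_spike[OF wderiv_cong[OF f], of _ "{}"]) auto
  \<comment> \<open>On \<open>{b..c}\<close> the pasted derivative may differ from \<open>g'\<close>
    only at \<open>b\<close>, a null set, while \<open>f b = g b\<close> makes the pasted function
    agree with \<open>g\<close> at \<open>b\<close> as well.\<close>
  show "wderiv b c (\<lambda>x. if x \<le> b then f x else g x) (\<lambda>x. if x \<le> b then f' x else g' x)"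
    by (rule wderiv_spike[OF wderiv_cong[OF g], of _ "{b}"]) (use assms(3) in auto)
qed

lemma wderiv_const: "a \<le> b \<Longrightarrow> wderiv a b (\<lambda>x. c) (\<lambda>x. 0)"
  by (auto intro!: wderivI)

lemma wderiv_ident: "a \<le> b \<Longrightarrow> wderiv a b (\<lambda>x. x) (\<lambda>x. 1)"
proof (rule wderivI)
  fix x assume "a \<le> x"
  then show "((\<lambda>x. 1) has_integral x - a) {a..x}" using has_integral_const_real[of "1::real" a x] by simp
qed (auto intro: L2_on_continuous)

lemma wderiv_negligible:
  assumes f: "wderiv a b f g"
  shows "negligible {x\<in>{a<..<b}. \<not> (f has_real_derivative g x) (at x)}"
proof -
  have "g integrable_on {a..b}" using wderiv_L2[OF f] by (simp add: L2_on_alt)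
  note neg = negligible_not_derivative_integral[OF this]
  have "(f has_real_derivative g x) (at x)" if x: "x \<in> {a<..<b}"
    "((\<lambda>x. integral {a..x} g) has_real_derivative g x) (at x)" for x
  proof -
    have 1: "((\<lambda>x. f a + integral {a..x} g) has_real_derivative g x) (at x)"
      using DERIV_add[OF DERIV_const that(2), of "f a"] by simp
    have ev: "\<forall>\<^sub>F t in nhds x. f t = f a + integral {a..t} g"
      using eventually_nhds_in_open[OF open_greaterThanLessThan x(1)]
      by eventually_elim (rule wderiv_eq[OF f], auto)
    show ?thesis using 1 DERIV_cong_ev[OF refl ev refl] by simp
  qed
  then show ?thesis by (intro negligible_subset[OF neg]) auto
qed

lemma wderiv_deriv_negligible:
  assumes f: "wderiv a b f g"
  shows "negligible {x\<in>{a<..<b}. \<not> (f differentiable at x \<and> deriv f x = g x)}"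
  by (rule negligible_subset[OF wderiv_negligible[OF f]])
    (auto simp: real_differentiable_def dest: DERIV_imp_deriv)

lemma negligible_real_open_closed:
  assumes "negligible {x\<in>{a<..<b::real}. P x}"
  shows "negligible {x\<in>{a..b}. P x}"
proof (rule negligible_subset)
  show "negligible ({x\<in>{a<..<b}. P x} \<union> {a,b})" using assms by (intro negligible_Un) auto
qed auto

text \<open>\<open>deriv\<close> is total, with an unspecified value where no derivative exists. By
  Lebesgue's theorem those points are negligible, so \<open>deriv f\<close> is itself a weak
  derivative; this connects the functional, written with \<open>deriv\<close>, to the Sobolev
  calculus.\<close>

lemma wderiv_deriv:
  assumes f: "wderiv a b f g"
  shows "wderiv a b f (deriv f)"
  by (rule wderiv_spike[OF f negligible_real_open_closed[OF wderiv_deriv_negligible[OF f]]]) auto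

text \<open>For a continuous weak derivative the fundamental theorem holds at every point,
  one-sidedly at the ends. The vertex derivatives in the Kirchhoff conditions are obtained from
  this.\<close>

lemma wderiv_continuous_deriv:
  assumes f: "wderiv a b f g" and g: "continuous_on {a..b} g" and x: "x \<in> {a..b}"
  shows "(f has_real_derivative g x) (at x within {a..b})"
proof -
  have "((\<lambda>x. integral {a..x} g) has_real_derivative g x) (at x within {a..b})"
    using integral_has_real_derivative[OF g x] .
  from DERIV_add[OF DERIV_const this, of "f a"]
  have "((\<lambda>x. f a + integral {a..x} g) has_real_derivative g x) (at x within {a..b})" by simp
  then show ?thesis
    by (rule has_field_derivative_transform_within[OF _ zero_less_one x]) (rule wderiv_eq[OF f, symmetric])
qed

text \<open>On \<open>[u,v]\<close> the defect of the formula is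
  \<open>\<integral> f' (g v - g) + g' (f u - f)\<close>, which by continuity is at most \<open>e \<integral> (\<bar>f'\<bar> + \<bar>g'\<bar>)\<close>
  on short intervals; such bounds add up over adjacent intervals.\<close>
lemma wderiv_parts:
  assumes F: "wderiv a b f f'" and G: "wderiv a b g g'"
  shows "((\<lambda>x. f x * g' x + f' x * g x) has_integral f b * g b - f a * g a) {a..b}"
proof -
  define h where "h = (\<lambda>x. f x * g' x + f' x * g x)"
  define k where "k = (\<lambda>x. \<bar>f' x\<bar> + \<bar>g' x\<bar>)"
  note ab = wderiv_le[OF F]
  have h: "h integrable_on {a..b}" unfolding h_def
    by (intro integrable_add L2_on_mult wderiv_L2_fun[OF F] wderiv_L2_fun[OF G] wderiv_L2[OF F] wderiv_L2[OF G])
  have k: "k integrable_on {a..b}" unfolding k_def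
    using wderiv_L2[OF F] wderiv_L2[OF G] by (intro integrable_add) (auto simp: L2_on_alt)
  have sub: "h integrable_on {u..v}" "k integrable_on {u..v}" if "a \<le> u" "v \<le> b" for u v
    using that integrable_subinterval_real[OF h, of u v] integrable_subinterval_real[OF k, of u v] by auto
  have main: "\<bar>f b * g b - f a * g a - integral {a..b} h\<bar> \<le> e * integral {a..b} k" if e: "e > 0" for e
  proof -
    define P where "P = (\<lambda>u v. a \<le> u \<longrightarrow> u \<le> v \<longrightarrow> v \<le> b \<longrightarrow>
      \<bar>f v * g v - f u * g u - integral {u..v} h\<bar> \<le> e * integral {u..v} k)"
    have "P a b" using ab
    proof (induction rule: Bolzano)
      case (trans u v w)
      show ?case unfolding P_def
      proof (intro impI)
        assume uw: "a \<le> u" "u \<le> w" "w \<le> b"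
        have "integral {u..v} h + integral {v..w} h = integral {u..w} h"
             "integral {u..v} k + integral {v..w} k = integral {u..w} k"
          using trans uw by (auto intro!: Henstock_Kurzweil_Integration.integral_combine sub)
        moreover have "\<bar>f v * g v - f u * g u - integral {u..v} h\<bar> \<le> e * integral {u..v} k"
          "\<bar>f w * g w - f v * g v - integral {v..w} h\<bar> \<le> e * integral {v..w} k"
          using trans uw unfolding P_def by auto
        ultimately show "\<bar>f w * g w - f u * g u - integral {u..w} h\<bar> \<le> e * integral {u..w} k"
          by (smt (verit) distrib_left)
      qed
    next
      case (local x)
      have "x \<in> {a..b}" using local by auto
      obtain d1 where d1: "d1 > 0" "\<And>s. s \<in> {a..b} \<Longrightarrow> dist s x < d1 \<Longrightarrow> dist (f s) (f x) < e/2"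
        using wderiv_continuous_on[OF F] \<open>x \<in> {a..b}\<close> e unfolding continuous_on_iff by (meson half_gt_zero)
      obtain d2 where d2: "d2 > 0" "\<And>s. s \<in> {a..b} \<Longrightarrow> dist s x < d2 \<Longrightarrow> dist (g s) (g x) < e/2"
        using wderiv_continuous_on[OF G] \<open>x \<in> {a..b}\<close> e unfolding continuous_on_iff by (meson half_gt_zero)
      have "P u v" if uv: "u \<le> x" "x \<le> v" "v - u < min d1 d2" for u v
        unfolding P_def
      proof (intro impI)
        assume uv': "a \<le> u" "u \<le> v" "v \<le> b"
        have cl: "\<bar>f s - f x\<bar> < e/2" "\<bar>g s - g x\<bar> < e/2" if "s \<in> {u..v}" for s
          using d1(2)[of s] d2(2)[of s] uv uv' that by (auto simp: dist_real_def)
        have "((\<lambda>s. (f' s * g v + f u * g' s) - h s) has_integral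
            ((f v - f u) * g v + f u * (g v - g u)) - integral {u..v} h) {u..v}"
          using uv' by (intro has_integral_diff has_integral_add has_integral_mult_left has_integral_mult_right
             wderiv_has_integral[OF F] wderiv_has_integral[OF G] integrable_integral sub)
        then have i: "((\<lambda>s. (f' s * g v + f u * g' s) - h s) has_integral
            f v * g v - f u * g u - integral {u..v} h) {u..v}" by (simp add: algebra_simps)
        have "norm (integral {u..v} (\<lambda>s. (f' s * g v + f u * g' s) - h s)) \<le> integral {u..v} (\<lambda>s. e * k s)"
        proof (rule Henstock_Kurzweil_Integration.integral_norm_bound_integral)
          show "(\<lambda>s. (f' s * g v + f u * g' s) - h s) integrable_on {u..v}" using i by blast
          show "(\<lambda>s. e * k s) integrable_on {u..v}" using uv' by (intro integrable_on_mult_right sub)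
          fix s assume s: "s \<in> {u..v}"
          have "\<bar>g v - g s\<bar> \<le> e" "\<bar>f u - f s\<bar> \<le> e"
            using cl[OF s] cl(2)[of v] cl(1)[of u] uv'(2) unfolding atLeastAtMost_iff by linarith+
          then have "\<bar>f' s\<bar> * \<bar>g v - g s\<bar> + \<bar>g' s\<bar> * \<bar>f u - f s\<bar> \<le> \<bar>f' s\<bar> * e + \<bar>g' s\<bar> * e"
            by (intro add_mono mult_left_mono) auto
          moreover have "(f' s * g v + f u * g' s) - h s = f' s * (g v - g s) + g' s * (f u - f s)"
            by (simp add: h_def algebra_simps)
          moreover have "\<bar>f' s * (g v - g s) + g' s * (f u - f s)\<bar> \<le> \<bar>f' s\<bar> * \<bar>g v - g s\<bar> + \<bar>g' s\<bar> * \<bar>f u - f s\<bar>"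
            by (metis abs_mult abs_triangle_ineq)
          ultimately show "norm ((f' s * g v + f u * g' s) - h s) \<le> e * k s"
            by (simp add: k_def algebra_simps)
        qed
        then show "\<bar>f v * g v - f u * g u - integral {u..v} h\<bar> \<le> e * integral {u..v} k"
          using integral_unique[OF i] by simp
      qed
      then show ?case using d1 d2 by (intro exI[of _ "min d1 d2"]) auto
    qed
    then show ?thesis using ab by (simp add: P_def)
  qed
  have "\<bar>f b * g b - f a * g a - integral {a..b} h\<bar> \<le> 0"
  proof (rule field_le_epsilon)
    fix e :: real assume e: "e > 0"
    have k0: "integral {a..b} k \<ge> 0" by (rule Henstock_Kurzweil_Integration.integral_nonneg[OF k]) (simp add: k_def)
    \<comment> \<open>The added 1 keeps the denominator positive when the integral of
      \<open>k\<close> vanishes.\<close>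
    have "\<bar>f b * g b - f a * g a - integral {a..b} h\<bar> \<le> e / (integral {a..b} k + 1) * integral {a..b} k"
      by (rule main) (use e k0 in auto)
    also have "\<dots> \<le> e" using e k0 by (simp add: divide_simps)
    finally show "\<bar>f b * g b - f a * g a - integral {a..b} h\<bar> \<le> 0 + e" by simp
  qed
  then have "integral {a..b} h = f b * g b - f a * g a" by simp
  then show ?thesis using integrable_integral[OF h] unfolding h_def by simp
qed

section \<open>The fundamental lemma of the calculus of variations\<close>

lemma wderiv_integral:
  assumes "a \<le> b" "L2_on a b g"
  shows "wderiv a b (\<lambda>x. integral {a..x} g) g"
  using assms by (simp add: wderiv_def)

text \<open>A nonnegative gauge-integrable function is Lebesgue integrable with the same integral,
  and a nonnegative Lebesgue integrand of integral 0 vanishes almost everywhere.\<close>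

lemma integral_square_eq_0:
  assumes "L2_on a b p" "integral {a..b} (\<lambda>x. (p x)\<^sup>2) = 0"
  shows "negligible {x\<in>{a..b}. p x \<noteq> 0}"
proof -
  have int: "integrable (lebesgue_on {a..b}) (\<lambda>x. (p x)\<^sup>2)"
    using assms(1) nonnegative_absolutely_integrable_1[of "\<lambda>x. (p x)\<^sup>2" "{a..b}"]
    by (simp add: L2_on_alt set_integrable_def integrable_restrict_space)
  have "integral\<^sup>L (lebesgue_on {a..b}) (\<lambda>x. (p x)\<^sup>2) = 0"
    using assms(2) int by (simp add: lebesgue_integral_eq_integral)
  then have "AE x in lebesgue_on {a..b}. (p x)\<^sup>2 = 0"
    using integral_nonneg_eq_0_iff_AE[OF int] by simp
  then have "AE x in lebesgue. x \<in> {a..b} \<longrightarrow> p x = 0"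
    by (simp add: AE_restrict_space_iff)
  then show ?thesis
    unfolding eventually_ae_filter_negligible by (auto intro: negligible_subset)
qed

text \<open>The test function is the primitive of \<open>w - H - C\<close>, where \<open>H\<close> is the primitive of
  \<open>h\<close> and \<open>C\<close> the mean of \<open>w - H\<close>.\<close>
lemma du_Bois_Reymond:
  assumes l: "0 < l" and w: "L2_on 0 l w" and h: "L2_on 0 l h"
    and test: "\<And>v v'. wderiv 0 l v v' \<Longrightarrow> v 0 = 0 \<Longrightarrow> v l = 0 \<Longrightarrow>
                integral {0..l} (\<lambda>t. w t * v' t + h t * v t) = 0"
  shows "\<exists>C. negligible {t\<in>{0..l}. w t \<noteq> C + integral {0..t} h}"
proof -
  define H where "H = (\<lambda>t. integral {0..t} h)"
  have H: "wderiv 0 l H h" unfolding H_def using l h by (intro wderiv_integral) auto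
  define C where "C = integral {0..l} (\<lambda>t. w t - H t) / l"
  define p where "p = (\<lambda>t. w t - H t - C)"
  have wH: "L2_on 0 l (\<lambda>t. w t - H t)" by (intro L2_on_diff w wderiv_L2_fun[OF H])
  have p: "L2_on 0 l p" unfolding p_def
    by (rule L2_on_diff[OF wH]) (auto intro: L2_on_continuous)
  define v where "v = (\<lambda>t. integral {0..t} p)"
  have v: "wderiv 0 l v p" unfolding v_def using l p by (intro wderiv_integral) auto
  have v0: "v 0 = 0" by (simp add: v_def)
  have "((\<lambda>t. (w t - H t) - C) has_integral integral {0..l} (\<lambda>t. w t - H t) - (l - 0) *\<^sub>R C) {0..l}"
    using l wH has_integral_const_real[of C 0 l]
    by (intro has_integral_diff integrable_integral) (auto simp: L2_on_alt)
  then have vl: "v l = 0" using l by (simp add: v_def p_def C_def integral_unique)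
  have ip: "(p has_integral 0) {0..l}"
    using wderiv_has_integral[OF v, of 0 l] l v0 vl by simp
  have 1: "((\<lambda>t. w t * p t + h t * v t) has_integral 0) {0..l}"
    using test[OF v v0 vl] integrable_integral[of "\<lambda>t. w t * p t + h t * v t" "{0..l}"]
      integrable_add[OF L2_on_mult[OF w p] L2_on_mult[OF h wderiv_L2_fun[OF v]]] by simp
  have 2: "((\<lambda>t. H t * p t + h t * v t) has_integral 0) {0..l}"
    using wderiv_parts[OF H v] v0 vl by simp
  \<comment> \<open>The \<open>h t * v t\<close> terms cancel, leaving
    \<open>(w t - H t - C) * p t\<close>, which is the square of \<open>p t\<close>.\<close>
  have "((\<lambda>t. (w t * p t + h t * v t) - (H t * p t + h t * v t) - C * p t) has_integral 0 - 0 - C * 0) {0..l}"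
    by (intro has_integral_diff 1 2 has_integral_mult_right ip)
  then have "((\<lambda>t. (p t)\<^sup>2) has_integral 0) {0..l}"
    by (simp add: p_def power2_eq_square algebra_simps)
  then have "negligible {t\<in>{0..l}. p t \<noteq> 0}"
    by (intro integral_square_eq_0 p) (auto dest: integral_unique)
  then show ?thesis
    by (intro exI[of _ C]) (rule negligible_subset, auto simp: p_def H_def)
qed

lemma W21_on_wderiv: "W21_on a b f \<Longrightarrow> wderiv a b f (deriv f)"
  unfolding W21_on_iff_wderiv using wderiv_deriv by blast

lemma W21_on_not_differentiable_negligible:
  assumes "W21_on a b f" shows "negligible {t\<in>{a..b}. \<not> f differentiable at t}"
proof -
  obtain g where "wderiv a b f g" using assms by (auto simp: W21_on_iff_wderiv)
  then have "negligible {t\<in>{a<..<b}. \<not> f differentiable at t}"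
    by (intro negligible_subset[OF wderiv_deriv_negligible]) auto
  then show ?thesis by (rule negligible_real_open_closed)
qed

section \<open>The quadratic functional on the tree\<close>

locale delayed_tree =
  fixes m d :: nat and k :: "nat \<Rightarrow> nat" and T :: "nat \<Rightarrow> real" and \<tau> :: real
    and b c :: "nat \<Rightarrow> real"
  assumes tree: "tree_setup m d k T \<tau>"
begin

abbreviation "L \<equiv> lens d T \<tau>"
abbreviation "E \<equiv> ell k T \<tau> b c"
abbreviation "Et \<equiv> ellt m k T \<tau> b c"
abbreviation "V \<equiv> Vset m k"
abbreviation "D \<equiv> ydel k T \<tau>"
abbreviation "J \<equiv> Jfun m k T \<tau> b c"

lemma m_ge: "1 \<le> m" "d < m" and k_1: "k 1 = 0" and \<tau>_ge: "0 \<le> \<tau>"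
  and k_mem: "j \<in> {2..m} \<Longrightarrow> k j \<in> {1..d}"
  and T_pos: "j \<in> {1..m} \<Longrightarrow> 0 < T j" and \<tau>_less: "j \<in> {1..m} \<Longrightarrow> \<tau> < T j"
  using tree by (auto simp: tree_setup_def)

text \<open>The iterates of a fixed point are constant, so reaching 1 would force
  \<open>j = 1\<close>, while \<open>k 1 = 0\<close>.\<close>

lemma k_neq: assumes "j \<in> {1..m}" shows "k j \<noteq> j"
proof
  assume k: "k j = j"
  have "(k ^^ n) j = j" for n by (induction n) (auto simp: k)
  moreover have "\<exists>n. (k ^^ n) j = 1" using tree assms unfolding tree_setup_def by blast
  ultimately show False using k k_1 by auto
qed

lemma L_bounds: assumes "j \<in> {1..m}"
  shows "0 < L j" "L j \<le> T j" "T j - \<tau> \<le> L j"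
  using T_pos[OF assms] \<tau>_less[OF assms] \<tau>_ge by (auto simp: lens_def)

lemma V_mem: "\<nu> \<in> V j \<Longrightarrow> 1 \<le> j \<Longrightarrow> \<nu> \<in> {2..m} \<and> k \<nu> = j"
  using k_1 by (cases "\<nu> = 1") (auto simp: Vset_def)

lemma finite_V [simp]: "finite (V j)"
  by (simp add: Vset_def)

text \<open>Each edge except the root edge starts at exactly one internal vertex. The identity moves
  both delayed terms and boundary values from child edges to their parent.\<close>

lemma sum_V:
  fixes f :: "nat \<Rightarrow> real"
  shows "(\<Sum>j\<in>{1..d}. \<Sum>\<nu>\<in>V j. f \<nu>) = (\<Sum>\<nu>\<in>{2..m}. f \<nu>)"
proof -
  have "(\<Sum>j\<in>{1..d}. \<Sum>\<nu>\<in>V j. f \<nu>) = (\<Sum>j\<in>{1..d}. \<Sum>\<nu>\<in>{\<nu>\<in>{2..m}. k \<nu> = j}. f \<nu>)"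
  proof (intro sum.cong refl)
    fix j assume "j \<in> {1..d}"
    then show "V j = {\<nu>\<in>{2..m}. k \<nu> = j}" using V_mem[of _ j] by (auto simp: Vset_def)
  qed
  also have "\<dots> = (\<Sum>\<nu>\<in>{2..m}. f \<nu>)"
    by (rule sum.group) (use k_mem in auto)
  finally show ?thesis .
qed

section \<open>Regularity of edge components and expansion of the cost\<close>

lemma W21_edge:
  assumes y: "in_W21_Ttau m T \<tau> y" and j: "j \<in> {1..m}"
  shows "W21_on 0 (T j) (y j)"
proof (cases "j = 1")
  case True
  have "wderiv (-\<tau>) (T 1) (y 1) (deriv (y 1))" using y by (auto simp: in_W21_Ttau_def intro: W21_on_wderiv)
  then show ?thesis unfolding W21_on_iff_wderiv True
    using wderiv_subinterval[of "-\<tau>" "T 1" "y 1" _ 0 "T 1"] \<tau>_ge T_pos[of 1] m_ge by auto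
next
  case False
  then show ?thesis using y j by (auto simp: in_W21_Ttau_def)
qed

lemma wderiv_edge:
  assumes y: "in_W21_Ttau m T \<tau> y" and j: "j \<in> {1..m}"
  shows "wderiv 0 (T j) (y j) (deriv (y j))"
  by (intro W21_on_wderiv W21_edge assms)

text \<open>For \<open>j = 1\<close> the delayed function is a translate of the component including
  its prehistory. On other edges the tail of the parent is pasted to a translate of
  \<open>y j\<close>, and continuity at the vertex makes the two pieces match.\<close>

lemma W21_ydel:
  assumes y: "in_W21_Ttau m T \<tau> y" and C: "cond_C m k T y" and j: "j \<in> {1..m}"
  shows "W21_on 0 (T j) (D y j)"
proof (cases "j = 1")
  case True
  have "wderiv (-\<tau>) (T 1) (y 1) (deriv (y 1))" using y by (auto simp: in_W21_Ttau_def intro: W21_on_wderiv)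
  from wderiv_shift[OF this, of "-\<tau>"]
  have "wderiv 0 (T 1 + \<tau>) (\<lambda>x. y 1 (x - \<tau>)) (\<lambda>x. deriv (y 1) (x - \<tau>))" by simp
  from wderiv_subinterval[OF this, of 0 "T 1"]
  have "wderiv 0 (T 1) (\<lambda>x. y 1 (x - \<tau>)) (\<lambda>x. deriv (y 1) (x - \<tau>))"
    using \<tau>_ge T_pos[of 1] m_ge by simp
  then have "wderiv 0 (T 1) (D y 1) (\<lambda>x. deriv (y 1) (x - \<tau>))"
    by (rule wderiv_cong) (simp add: ydel_def)
  then show ?thesis unfolding W21_on_iff_wderiv True by blast
next
  case False
  then have j2: "j \<in> {2..m}" using j by auto
  define i where "i = k j"
  have i: "i \<in> {1..m}" using k_mem[OF j2] m_ge by (auto simp: i_def)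
  have Ti: "\<tau> < T i" and Tj: "\<tau> < T j" using \<tau>_less i j by auto
  have 1: "wderiv 0 \<tau> (\<lambda>x. y i (x + (T i - \<tau>))) (\<lambda>x. deriv (y i) (x + (T i - \<tau>)))"
    using wderiv_shift[OF wderiv_subinterval[OF wderiv_edge[OF y i], of "T i - \<tau>" "T i"], of "T i - \<tau>"] Ti \<tau>_ge
    by simp
  have "wderiv \<tau> (T j + \<tau>) (\<lambda>x. y j (x + -\<tau>)) (\<lambda>x. deriv (y j) (x + -\<tau>))"
    using wderiv_shift[OF wderiv_edge[OF y j], of "-\<tau>"] by simp
  then have 2: "wderiv \<tau> (T j) (\<lambda>x. y j (x + -\<tau>)) (\<lambda>x. deriv (y j) (x + -\<tau>))"
    by (rule wderiv_subinterval) (use \<tau>_ge Tj in auto)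
  have C': "y j 0 = y i (T i)" using C j2 by (auto simp: cond_C_def i_def)
  have "wderiv 0 (T j) (\<lambda>x. if x \<le> \<tau> then y i (x + (T i - \<tau>)) else y j (x + -\<tau>))
     (\<lambda>x. if x \<le> \<tau> then deriv (y i) (x + (T i - \<tau>)) else deriv (y j) (x + -\<tau>))"
    by (rule wderiv_paste[OF 1 2]) (simp add: C')
  then have "wderiv 0 (T j) (D y j)
     (\<lambda>x. if x \<le> \<tau> then deriv (y i) (x + (T i - \<tau>)) else deriv (y j) (x + -\<tau>))"
  \<comment> \<open>At \<open>x = \<tau>\<close> the delayed value is already read on the edge
    itself, whereas the pasted function still reads the parent; \<open>C'\<close> identifies the two
    values.\<close>
  proof (rule wderiv_cong)
    fix x
    consider "x < \<tau>" | "x = \<tau>" | "x > \<tau>" by linarith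
    then show "D y j x = (if x \<le> \<tau> then y i (x + (T i - \<tau>)) else y j (x + -\<tau>))"
      using j2 C' by cases (auto simp: ydel_def i_def algebra_simps)
  qed
  then show ?thesis unfolding W21_on_iff_wderiv by blast
qed

lemma L2_ydel:
  assumes "in_W21_Ttau m T \<tau> y" "cond_C m k T y" "j \<in> {1..m}"
  shows "L2_on 0 (T j) (D y j)"
  by (rule wderiv_L2_fun[OF W21_on_wderiv[OF W21_ydel[OF assms]]])

lemma L2_ell:
  assumes y: "in_W21_Ttau m T \<tau> y" "cond_C m k T y" and j: "j \<in> {1..m}"
  shows "L2_on 0 (T j) (E y j)"
  unfolding ell_def
  by (intro L2_on_add L2_on_cmult L2_ydel[OF y j] wderiv_L2_fun[OF wderiv_edge[OF y(1) j]] wderiv_L2[OF wderiv_edge[OF y(1) j]])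

text \<open>\<open>deriv\<close> is additive only where both functions are differentiable, so
  linearity of the operator is claimed off a null set.\<close>

lemma ell_linear:
  assumes y: "in_W21_Ttau m T \<tau> y" and v: "in_W21_Ttau m T \<tau> v" and j: "j \<in> {1..m}"
  shows "negligible {t\<in>{0..T j}. E (\<lambda>i t. y i t + s * v i t) j t \<noteq> E y j t + s * E v j t}"
proof (rule negligible_subset)
  show "negligible ({t\<in>{0..T j}. \<not> y j differentiable at t} \<union> {t\<in>{0..T j}. \<not> v j differentiable at t})"
    by (intro negligible_Un W21_on_not_differentiable_negligible W21_edge y v j)
  have "E (\<lambda>i t. y i t + s * v i t) j t = E y j t + s * E v j t"
    if "y j differentiable at t" "v j differentiable at t" for t
  proof -
    have "(y j has_real_derivative deriv (y j) t) (at t)" "(v j has_real_derivative deriv (v j) t) (at t)"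
      using that by (auto simp: DERIV_deriv_iff_real_differentiable)
    then have "((\<lambda>t. y j t + s * v j t) has_real_derivative deriv (y j) t + s * deriv (v j) t) (at t)"
      by (auto intro!: derivative_eq_intros)
    then have "deriv (\<lambda>t. y j t + s * v j t) t = deriv (y j) t + s * deriv (v j) t"
      by (rule DERIV_imp_deriv)
    then show ?thesis by (simp add: ell_def ydel_def algebra_simps)
  qed
  then show "{t\<in>{0..T j}. E (\<lambda>i t. y i t + s * v i t) j t \<noteq> E y j t + s * E v j t} \<subseteq>
    {t\<in>{0..T j}. \<not> y j differentiable at t} \<union> {t\<in>{0..T j}. \<not> v j differentiable at t}"
    by blast
qed

definition B :: "(nat \<Rightarrow> real \<Rightarrow> real) \<Rightarrow> (nat \<Rightarrow> real \<Rightarrow> real) \<Rightarrow> real" where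
  "B y v = (\<Sum>j=1..m. integral {0..T j} (\<lambda>t. E y j t * E v j t))"

lemma J_expand:
  assumes y: "in_W21_Ttau m T \<tau> y" "cond_C m k T y" and v: "in_W21_Ttau m T \<tau> v" "cond_C m k T v"
  shows "J (\<lambda>i t. y i t + s * v i t) = J y + 2 * s * B y v + s\<^sup>2 * J v"
proof -
  have "integral {0..T j} (\<lambda>t. (E (\<lambda>i t. y i t + s * v i t) j t)\<^sup>2) =
     integral {0..T j} (\<lambda>t. (E y j t)\<^sup>2) + 2 * s * integral {0..T j} (\<lambda>t. E y j t * E v j t)
       + s\<^sup>2 * integral {0..T j} (\<lambda>t. (E v j t)\<^sup>2)" if j: "j \<in> {1..m}" for j
  proof -
    note Ly = L2_ell[OF y j] and Lv = L2_ell[OF v j]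
    have "((\<lambda>t. (E y j t)\<^sup>2 + 2 * s * (E y j t * E v j t) + s\<^sup>2 * (E v j t)\<^sup>2) has_integral
       integral {0..T j} (\<lambda>t. (E y j t)\<^sup>2) + 2 * s * integral {0..T j} (\<lambda>t. E y j t * E v j t)
       + s\<^sup>2 * integral {0..T j} (\<lambda>t. (E v j t)\<^sup>2)) {0..T j}"
      using Ly Lv L2_on_mult[OF Ly Lv]
      by (intro has_integral_add has_integral_mult_right integrable_integral) (auto simp: L2_on_alt)
    then have "((\<lambda>t. (E (\<lambda>i t. y i t + s * v i t) j t)\<^sup>2) has_integral
       integral {0..T j} (\<lambda>t. (E y j t)\<^sup>2) + 2 * s * integral {0..T j} (\<lambda>t. E y j t * E v j t)
       + s\<^sup>2 * integral {0..T j} (\<lambda>t. (E v j t)\<^sup>2)) {0..T j}"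
      by (rule has_integral_spike[OF ell_linear[OF y(1) v(1) j, of s], rotated])
        (auto simp: power2_eq_square algebra_simps)
    then show ?thesis by (rule integral_unique)
  qed
  then show ?thesis
    by (simp add: Jfun_def B_def sum.distrib sum_distrib_left)
qed

section \<open>The adjoint delay term and the rearranged bilinear form\<close>

lemma L2_ellt_left:
  assumes y: "in_W21_Ttau m T \<tau> y" "cond_C m k T y" and j: "j \<in> {1..m}"
  shows "L2_on 0 (T j - \<tau>) (Et y j)"
proof -
  have "L2_on 0 (T j - \<tau>) (\<lambda>t. c j * E y j (t + \<tau>))"
    using L2_on_shift[OF L2_on_subinterval[OF L2_ell[OF y j], of \<tau> "T j"], of \<tau>] \<tau>_ge
    by (intro L2_on_cmult) simp
  then show ?thesis
    \<comment> \<open>At the right endpoint \<open>ellt\<close> already takes the vertex-sum branch;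
      this is a single point.\<close>
    by (rule L2_on_spike[of _ _ _ "{T j - \<tau>}"]) (auto simp: ellt_def)
qed

lemma L2_ellt_right:
  assumes y: "in_W21_Ttau m T \<tau> y" "cond_C m k T y" and j: "j \<in> {1..d}"
  shows "L2_on (T j - \<tau>) (T j) (Et y j)"
proof -
  have "L2_on (T j - \<tau>) (T j) (\<lambda>t. \<Sum>\<nu>\<in>V j. c \<nu> * E y \<nu> (t + (\<tau> - T j)))"
  proof (intro L2_on_sum L2_on_cmult)
    fix \<nu> assume \<nu>: "\<nu> \<in> V j"
    then have \<nu>m: "\<nu> \<in> {1..m}" by (auto simp: Vset_def)
    show "L2_on (T j - \<tau>) (T j) (\<lambda>t. E y \<nu> (t + (\<tau> - T j)))"
      using L2_on_shift[OF L2_on_subinterval[OF L2_ell[OF y \<nu>m], of 0 \<tau>], of "\<tau> - T j"] \<tau>_less[OF \<nu>m] by simp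
  qed
  then show ?thesis
    by (rule L2_on_cong) (auto simp: ellt_def algebra_simps)
qed

lemma L2_ellt:
  assumes y: "in_W21_Ttau m T \<tau> y" "cond_C m k T y" and j: "j \<in> {1..m}"
  shows "L2_on 0 (L j) (Et y j)"
proof (cases "j \<le> d")
  case True
  then show ?thesis
    using L2_on_combine[OF L2_ellt_left[OF y j] L2_ellt_right[OF y]] j \<tau>_less[OF j] \<tau>_ge by (simp add: lens_def)
qed (use L2_ellt_left[OF y j] in \<open>simp add: lens_def\<close>)

text \<open>The Euler--Lagrange density of the edge functional: the coefficient of \<open>v\<^sub>j\<close> in \<open>B y v\<close>.\<close>
definition H :: "(nat \<Rightarrow> real \<Rightarrow> real) \<Rightarrow> nat \<Rightarrow> real \<Rightarrow> real" where
  "H y j t = b j * E y j t + Et y j t"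

lemma L2_H:
  assumes y: "in_W21_Ttau m T \<tau> y" "cond_C m k T y" and j: "j \<in> {1..m}"
  shows "L2_on 0 (L j) (H y j)"
  unfolding H_def using L_bounds[OF j]
  by (intro L2_on_add L2_on_cmult L2_ellt[OF y j] L2_on_subinterval[OF L2_ell[OF y j]]) auto

text \<open>The delayed part of an edge is split at \<open>\<tau>\<close>: \<open>Q j\<close> reads
  \<open>v\<close> on the same edge, and \<open>P j\<close> reads the last stretch of the parent.
  Translating both and regrouping the \<open>P \<nu>\<close> by parent produces exactly the adjoint
  term \<open>Et\<close>, integrated against \<open>v\<close> in \<open>R\<close>; the undelayed
  part is \<open>S\<close>. The target condition permits cutting the integrals at
  \<open>L j\<close>.\<close>

lemma B_eq:
  assumes y: "in_W21_Ttau m T \<tau> y" "cond_C m k T y" and v: "admissible m d k T \<tau> (\<lambda>t. 0) v"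
  shows "B y v = (\<Sum>j=1..m. integral {0..L j} (\<lambda>t. E y j t * deriv (v j) t + H y j t * v j t))"
proof -
  have vW: "in_W21_Ttau m T \<tau> v" and vC: "cond_C m k T v" and vI: "cond_I \<tau> (\<lambda>t. 0) v" and vZ: "cond_Z m d T \<tau> v"
    using v by (auto simp: admissible_def)
  define P where "P j = integral {0..\<tau>} (\<lambda>t. c j * E y j t * D v j t)" for j
  define Q where "Q j = integral {0..T j - \<tau>} (\<lambda>t. Et y j t * v j t)" for j
  define R where "R j = integral {0..L j} (\<lambda>t. Et y j t * v j t)" for j
  define S where "S j = integral {0..L j} (\<lambda>t. E y j t * (deriv (v j) t + b j * v j t))" for j
  have v_zero: "v j t = 0" "deriv (v j) t = 0" if "j \<in> {1..m}" "t \<in> {L j<..<T j}" for j t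
  proof -
    \<comment> \<open>For \<open>j \<le> d\<close> one has \<open>L j = T j\<close>, so the open
      interval is empty and only edges ending at a target remain.\<close>
    have jd: "j \<in> {d+1..m}" using that by (auto simp: lens_def split: if_splits)
    have z: "v j s = 0" if "s \<in> {L j..T j}" for s
      using vZ jd that by (auto simp: cond_Z_def lens_def)
    then show "v j t = 0" using that by auto
    have "\<forall>\<^sub>F s in nhds t. v j s = 0"
      using eventually_nhds_in_open[OF open_greaterThanLessThan that(2)] by eventually_elim (use z in auto)
    from deriv_cong_ev[OF this refl] show "deriv (v j) t = 0" by simp
  qed
  have L2v: "L2_on 0 (T j) (v j)" "L2_on 0 (T j) (deriv (v j))" if j: "j \<in> {1..m}" for j
    using wderiv_L2_fun[OF wderiv_edge[OF vW j]] wderiv_L2[OF wderiv_edge[OF vW j]] by auto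
  have edge: "integral {0..T j} (\<lambda>t. E y j t * E v j t) = S j + P j + Q j" if j: "j \<in> {1..m}" for j
  proof -
    note Ly = L2_ell[OF y j]
    have LS: "L2_on 0 (T j) (\<lambda>t. deriv (v j) t + b j * v j t)"
      by (intro L2_on_add L2_on_cmult L2v j)
    have i1: "(\<lambda>t. E y j t * (deriv (v j) t + b j * v j t)) integrable_on {0..T j}"
      by (rule L2_on_mult[OF Ly LS])
    \<comment> \<open>The two endpoints are excepted because \<open>deriv (v j)\<close> is not
      controlled there.\<close>
    have "integral {L j..T j} (\<lambda>t. E y j t * (deriv (v j) t + b j * v j t)) = integral {L j..T j} (\<lambda>t. 0)"
      by (rule integral_spike[of "{L j, T j}"]) (use v_zero[OF j] in auto)
    then have S: "integral {0..T j} (\<lambda>t. E y j t * (deriv (v j) t + b j * v j t)) = S j"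
      using Henstock_Kurzweil_Integration.integral_combine[OF _ _ i1, of "L j"] L_bounds[OF j] by (simp add: S_def)
    have i2: "(\<lambda>t. c j * E y j t * D v j t) integrable_on {0..T j}"
      by (intro L2_on_mult L2_on_cmult Ly L2_ydel[OF vW vC j])
    have i2': "(\<lambda>t. c j * E y j t * v j (t - \<tau>)) integrable_on {\<tau>..T j}"
    proof (rule integrable_eq)
      show "(\<lambda>t. c j * E y j t * D v j t) integrable_on {\<tau>..T j}"
        using \<tau>_ge by (intro integrable_subinterval_real[OF i2]) auto
    qed (auto simp: ydel_def)
    have "integral {\<tau>..T j} (\<lambda>t. c j * E y j t * D v j t) = integral {\<tau>..T j} (\<lambda>t. c j * E y j t * v j (t - \<tau>))"
      by (rule Henstock_Kurzweil_Integration.integral_cong) (auto simp: ydel_def)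
    also have "\<dots> = integral {\<tau> - \<tau>..T j - \<tau>} (\<lambda>t. c j * E y j (t + \<tau>) * v j (t + \<tau> - \<tau>))"
      using integral_shift_real[OF i2', of \<tau>] by simp
    also have "\<dots> = Q j"
      unfolding Q_def diff_self by (rule integral_spike[of "{T j - \<tau>}"]) (auto simp: ellt_def)
    finally have "integral {0..T j} (\<lambda>t. c j * E y j t * D v j t) = P j + Q j"
      using Henstock_Kurzweil_Integration.integral_combine[OF _ _ i2, of \<tau>] \<tau>_ge \<tau>_less[OF j] by (simp add: P_def)
    moreover have "integral {0..T j} (\<lambda>t. E y j t * E v j t) =
      integral {0..T j} (\<lambda>t. E y j t * (deriv (v j) t + b j * v j t) + c j * E y j t * D v j t)"
      by (simp add: ell_def algebra_simps)
    ultimately show ?thesis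
      using Henstock_Kurzweil_Integration.integral_add[OF i1 i2] S by simp
  qed
  \<comment> \<open>The final stretch of length \<open>\<tau>\<close> of an internal edge collects
    the terms \<open>P \<nu>\<close> of all its child edges.\<close>
  have R1: "R j = Q j + (\<Sum>\<nu>\<in>V j. P \<nu>)" if j: "j \<in> {1..d}" for j
  proof -
    have jm: "j \<in> {1..m}" using j m_ge by auto
    have i: "(\<lambda>t. Et y j t * v j t) integrable_on {0..T j}"
      using L2_on_mult[OF L2_ellt[OF y jm] L2_on_subinterval[OF L2v(1)[OF jm], of 0 "L j"]] j by (simp add: lens_def)
    have "integral {T j - \<tau>..T j} (\<lambda>t. Et y j t * v j t) =
      integral {T j - \<tau>..T j} (\<lambda>t. \<Sum>\<nu>\<in>V j. c \<nu> * E y \<nu> (t + \<tau> - T j) * v j t)"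
      by (rule Henstock_Kurzweil_Integration.integral_cong) (auto simp: ellt_def sum_distrib_right)
    also have "\<dots> = (\<Sum>\<nu>\<in>V j. P \<nu>)"
    proof (rule integral_unique, intro has_integral_sum finite_V)
      fix \<nu> assume \<nu>: "\<nu> \<in> V j"
      have \<nu>m: "\<nu> \<in> {1..m}" and \<nu>2: "\<nu> \<ge> 2" and k\<nu>: "k \<nu> = j" using V_mem[OF \<nu>] j by auto
      have i: "(\<lambda>t. c \<nu> * E y \<nu> t * D v \<nu> t) integrable_on {0..\<tau>}"
        using L2_on_mult[OF L2_on_cmult[OF L2_ell[OF y \<nu>m]] L2_ydel[OF vW vC \<nu>m]]
        by (rule integrable_subinterval_real) (use \<tau>_less[OF \<nu>m] in auto)
      have "((\<lambda>t. c \<nu> * E y \<nu> (t + (\<tau> - T j)) * D v \<nu> (t + (\<tau> - T j))) has_integral P \<nu>)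
         {0 - (\<tau> - T j)..\<tau> - (\<tau> - T j)}"
        unfolding P_def by (rule has_integral_shift_real) (rule integrable_integral[OF i])
      then have *: "((\<lambda>t. c \<nu> * E y \<nu> (t + (\<tau> - T j)) * D v \<nu> (t + (\<tau> - T j))) has_integral P \<nu>) {T j - \<tau>..T j}"
        by simp
      \<comment> \<open>At \<open>t = T j\<close> the shifted argument is \<open>\<tau>\<close>,
        where \<open>ydel\<close> no longer reads the parent edge.\<close>
      show "((\<lambda>t. c \<nu> * E y \<nu> (t + \<tau> - T j) * v j t) has_integral P \<nu>) {T j - \<tau>..T j}"
        by (rule has_integral_spike[OF _ _ *, of "{T j}"]) (use \<nu>2 k\<nu> in \<open>auto simp: ydel_def algebra_simps\<close>)
    qed
    finally show ?thesis
      using Henstock_Kurzweil_Integration.integral_combine[OF _ _ i, of "T j - \<tau>"] \<tau>_ge \<tau>_less[OF jm] j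
      by (simp add: R_def Q_def lens_def)
  qed
  have R2: "R j = Q j" if j: "j \<in> {d+1..m}" for j
    using j by (simp add: R_def Q_def lens_def)
  \<comment> \<open>The root edge has no parent: its early delayed values are the prehistory of
    \<open>v\<close>, which is zero.\<close>
  have P1: "P 1 = 0"
  proof -
    have "P 1 = integral {0..\<tau>} (\<lambda>t. 0)" unfolding P_def
      by (rule Henstock_Kurzweil_Integration.integral_cong) (use vI in \<open>auto simp: ydel_def cond_I_def\<close>)
    then show ?thesis by simp
  qed
  have split_m: "{1..m} = {1..d} \<union> {d+1..m}" using m_ge by auto
  have "(\<Sum>j\<in>{1..m}. R j) = (\<Sum>j\<in>{1..d}. Q j + (\<Sum>\<nu>\<in>V j. P \<nu>)) + (\<Sum>j\<in>{d+1..m}. Q j)"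
    unfolding split_m by (subst sum.union_disjoint) (auto simp: R1 R2)
  also have "\<dots> = (\<Sum>j\<in>{1..m}. Q j) + (\<Sum>\<nu>\<in>{2..m}. P \<nu>)"
    unfolding split_m sum.distrib sum_V by (subst sum.union_disjoint) auto
  also have "(\<Sum>\<nu>\<in>{2..m}. P \<nu>) = (\<Sum>j\<in>{1..m}. P j)"
  proof -
    have "{1..m} = insert 1 {2..m}" using m_ge by auto
    then show ?thesis using P1 by simp
  qed
  finally have R: "(\<Sum>j\<in>{1..m}. R j) = (\<Sum>j\<in>{1..m}. P j + Q j)" by (simp add: sum.distrib)
  have "integral {0..L j} (\<lambda>t. E y j t * deriv (v j) t + H y j t * v j t) = S j + R j" if j: "j \<in> {1..m}" for j
  proof -
    have sub: "L2_on 0 (L j) (v j)" "L2_on 0 (L j) (deriv (v j))" "L2_on 0 (L j) (E y j)"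
      using L2v[OF j] L2_ell[OF y j] L_bounds[OF j] by (auto intro: L2_on_subinterval)
    have "integral {0..L j} (\<lambda>t. E y j t * (deriv (v j) t + b j * v j t) + Et y j t * v j t) = S j + R j"
      unfolding S_def R_def
      by (intro Henstock_Kurzweil_Integration.integral_add L2_on_mult L2_on_add L2_on_cmult sub L2_ellt[OF y j])
    then show ?thesis by (simp add: H_def algebra_simps)
  qed
  then have "(\<Sum>j=1..m. integral {0..L j} (\<lambda>t. E y j t * deriv (v j) t + H y j t * v j t)) = (\<Sum>j\<in>{1..m}. S j + R j)"
    by (intro sum.cong) auto
  also have "\<dots> = (\<Sum>j\<in>{1..m}. S j + P j + Q j)" using R by (simp add: sum.distrib)
  also have "\<dots> = B y v" unfolding B_def by (intro sum.cong) (auto simp: edge)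
  finally show ?thesis by simp
qed
end

section \<open>Euler--Lagrange equations and vertex conditions\<close>

lemma AE_interval_iff_negligible:
  "(AE t in lebesgue. t \<in> {a<..<b::real} \<longrightarrow> P t) \<longleftrightarrow> negligible {t\<in>{a<..<b}. \<not> P t}"
proof
  assume "AE t in lebesgue. t \<in> {a<..<b} \<longrightarrow> P t"
  then show "negligible {t\<in>{a<..<b}. \<not> P t}"
    unfolding eventually_ae_filter_negligible by (auto intro: negligible_subset)
next
  assume "negligible {t\<in>{a<..<b}. \<not> P t}"
  then show "AE t in lebesgue. t \<in> {a<..<b} \<longrightarrow> P t"
    unfolding eventually_ae_filter_negligible by (intro exI[of _ "{t\<in>{a<..<b}. \<not> P t}"]) auto
qed

lemma W21_on_add: "W21_on a b f \<Longrightarrow> W21_on a b g \<Longrightarrow> W21_on a b (\<lambda>t. f t + g t)"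
  unfolding W21_on_iff_wderiv using wderiv_add by blast

lemma W21_on_diff: "W21_on a b f \<Longrightarrow> W21_on a b g \<Longrightarrow> W21_on a b (\<lambda>t. f t - g t)"
  unfolding W21_on_iff_wderiv using wderiv_diff by blast

lemma W21_on_cmult: "W21_on a b f \<Longrightarrow> W21_on a b (\<lambda>t. s * f t)"
  unfolding W21_on_iff_wderiv using wderiv_cmult by blast

lemma W21_on_0: "a \<le> b \<Longrightarrow> W21_on a b (\<lambda>t. 0)"
  unfolding W21_on_iff_wderiv by (blast intro: wderiv_const)

lemma W21_on_extend_left:
  assumes v: "W21_on 0 l v" and "v 0 = 0" "a \<le> 0"
  shows "W21_on a l (\<lambda>t. if t \<le> 0 then 0 else v t)"
  using assms wderiv_paste[OF wderiv_const[of a 0 0]] unfolding W21_on_iff_wderiv by fastforce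

lemma W21_on_extend_right:
  assumes v: "W21_on a l v" and "v l = 0" "l \<le> b"
  shows "W21_on a b (\<lambda>t. if t \<le> l then v t else 0)"
  using assms wderiv_paste[OF _ wderiv_const[of l b 0]] unfolding W21_on_iff_wderiv by fastforce

lemma deriv_eq_on_open_interval:
  fixes f g :: "real \<Rightarrow> real"
  assumes "\<And>s. s \<in> {a<..<b} \<Longrightarrow> f s = g s" "t \<in> {a<..<b}"
  shows "deriv f t = deriv g t"
proof -
  have "\<forall>\<^sub>F s in nhds t. f s = g s"
    using eventually_nhds_in_open[OF open_greaterThanLessThan assms(2)] by eventually_elim (rule assms(1))
  then show ?thesis by (rule deriv_cong_ev) simp
qed

context delayed_tree
begin

section \<open>The Euler-Lagrange equation on a single edge\<close>

context
  fixes y :: "nat \<Rightarrow> real \<Rightarrow> real" and j :: nat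
  assumes y: "in_W21_Ttau m T \<tau> y" and yC: "cond_C m k T y" and j: "j \<in> {1..m}"
begin

text \<open>Solving \<open>E y j = W\<close> for the derivative gives a weak derivative
  \<open>G\<close> of \<open>y j\<close> that is itself in \<open>W21_on\<close>. This is the
  second-order regularity, and continuity of \<open>G\<close> turns the relation into a pointwise
  one, one-sided at the ends.\<close>

lemma Euler_Lagrange_regularity:
  assumes W: "wderiv 0 (L j) W (H y j)" and N: "negligible {t\<in>{0..L j}. E y j t \<noteq> W t}"
  shows "W22_on 0 (L j) (y j)"
    and "\<And>t. t \<in> {0..L j} \<Longrightarrow>
      (y j has_real_derivative W t - b j * y j t - c j * D y j t) (at t within {0..L j})"
    and "negligible {t\<in>{0<..<L j}. Lop m k T \<tau> b c y j t \<noteq> 0}"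
proof -
  define G where "G t = W t - b j * y j t - c j * D y j t" for t
  note L = L_bounds[OF j]
  have yj: "wderiv 0 (L j) (y j) (deriv (y j))"
    using L by (intro wderiv_subinterval[OF wderiv_edge[OF y j]]) auto
  have Dj: "wderiv 0 (L j) (D y j) (deriv (D y j))"
    using L by (intro wderiv_subinterval[OF W21_on_wderiv[OF W21_ydel[OF y yC j]]]) auto
  have G: "W21_on 0 (L j) G"
    unfolding G_def by (intro W21_on_diff W21_on_cmult) (use W yj Dj W21_on_iff_wderiv in blast)+
  have yG: "wderiv 0 (L j) (y j) G"
    by (rule wderiv_spike[OF yj N]) (auto simp: G_def ell_def)
  show W22: "W22_on 0 (L j) (y j)"
    unfolding W22_on_def using G wderiv_eq[OF yG] wderiv_le[OF yG] by blast
  have Gc: "continuous_on {0..L j} G" by (rule wderiv_continuous_on[OF W21_on_wderiv[OF G]])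
  show der: "(y j has_real_derivative W t - b j * y j t - c j * D y j t) (at t within {0..L j})"
    if "t \<in> {0..L j}" for t
    using wderiv_continuous_deriv[OF yG Gc that] by (simp add: G_def)
  \<comment> \<open>Equality almost everywhere would not suffice here: \<open>Lop\<close> applies
    \<open>deriv\<close> to \<open>E y j\<close>, which is sensitive to changes on null
    sets.\<close>
  have EW: "E y j t = W t" if t: "t \<in> {0<..<L j}" for t
  proof -
    have "(y j has_real_derivative G t) (at t)"
      using der[of t] t at_within_Icc_at[of 0 t "L j"] by (simp add: G_def)
    then have "deriv (y j) t = G t" by (rule DERIV_imp_deriv)
    then show ?thesis by (simp add: ell_def G_def)
  qed
  show "negligible {t\<in>{0<..<L j}. Lop m k T \<tau> b c y j t \<noteq> 0}"
  proof (rule negligible_subset[OF wderiv_deriv_negligible[OF W]], clarify)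
    fix t assume t: "t \<in> {0<..<L j}" "Lop m k T \<tau> b c y j t \<noteq> 0" "W differentiable at t" "deriv W t = H y j t"
    have "deriv (\<lambda>s. E y j s) t = deriv W t" using EW t(1) by (rule deriv_eq_on_open_interval)
    then show False using t by (simp add: Lop_def H_def)
  qed
qed

text \<open>Conversely, inserting the continuous derivative \<open>G\<close> into the operator gives
  a representative \<open>W\<close> of \<open>E y j\<close> that is in \<open>W21_on\<close>, and
  the vanishing of \<open>Lop\<close> says that its derivative is \<open>H y j\<close> almost
  everywhere.\<close>

lemma Euler_Lagrange_weak:
  assumes W22: "W22_on 0 (L j) (y j)" and N: "negligible {t\<in>{0<..<L j}. Lop m k T \<tau> b c y j t \<noteq> 0}"
  shows "\<exists>W. wderiv 0 (L j) W (H y j) \<and> negligible {t\<in>{0..L j}. E y j t \<noteq> W t}"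
proof -
  note L = L_bounds[OF j]
  obtain G where G: "W21_on 0 (L j) G" "\<And>x. x \<in> {0..L j} \<Longrightarrow> y j x = y j 0 + integral {0..x} G"
    using W22 unfolding W22_on_def by blast
  have Gc: "continuous_on {0..L j} G" by (rule wderiv_continuous_on[OF W21_on_wderiv[OF G(1)]])
  have yG: "wderiv 0 (L j) (y j) G"
    unfolding wderiv_def using less_imp_le[OF L(1)] G(2) L2_on_continuous[OF Gc] by blast
  have Dj: "wderiv 0 (L j) (D y j) (deriv (D y j))"
    using L by (intro wderiv_subinterval[OF W21_on_wderiv[OF W21_ydel[OF y yC j]]]) auto
  define W where "W t = G t + b j * y j t + c j * D y j t" for t
  have W': "wderiv 0 (L j) W (deriv W)"
  proof (rule W21_on_wderiv)
    show "W21_on 0 (L j) W"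
      unfolding W_def by (intro W21_on_add W21_on_cmult) (use G(1) yG Dj W21_on_iff_wderiv in blast)+
  qed
  have EW: "E y j t = W t" if t: "t \<in> {0<..<L j}" for t
  proof -
    have "(y j has_real_derivative G t) (at t)"
      using wderiv_continuous_deriv[OF yG Gc, of t] t at_within_Icc_at[of 0 t "L j"] by simp
    then have "deriv (y j) t = G t" by (rule DERIV_imp_deriv)
    then show ?thesis by (simp add: ell_def W_def)
  qed
  have "wderiv 0 (L j) W (H y j)"
  proof (rule wderiv_spike[OF W' negligible_real_open_closed])
    show "negligible {t\<in>{0<..<L j}. deriv W t \<noteq> H y j t}"
    proof (rule negligible_subset[OF N], clarify)
      fix t assume t: "t \<in> {0<..<L j}" "deriv W t \<noteq> H y j t" "Lop m k T \<tau> b c y j t = 0"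
      have "deriv (\<lambda>s. E y j s) t = deriv W t" using EW t(1) by (rule deriv_eq_on_open_interval)
      then show False using t by (simp add: Lop_def H_def)
    qed
  qed auto
  moreover have "negligible {t\<in>{0..L j}. E y j t \<noteq> W t}"
  proof (rule negligible_subset)
    show "{t\<in>{0..L j}. E y j t \<noteq> W t} \<subseteq> {0, L j}"
    proof
      fix t assume t: "t \<in> {t\<in>{0..L j}. E y j t \<noteq> W t}"
      then have "t \<notin> {0<..<L j}" using EW by blast
      then show "t \<in> {0, L j}" using t by auto
    qed
  qed simp
  ultimately show ?thesis by blast
qed

end

text \<open>Here \<open>W\<close> stands for the continuous representative of \<open>E y\<close>, so
  its endpoint values make sense: inflow at an internal vertex minus the outflow into the child
  edges.\<close>

definition flux_jump :: "(nat \<Rightarrow> real \<Rightarrow> real) \<Rightarrow> nat \<Rightarrow> real" where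
  "flux_jump W j = W j (T j) - (\<Sum>\<nu>\<in>V j. W \<nu> 0)"

text \<open>Integration by parts on each edge leaves only endpoint terms. They vanish at the targets
  by \<open>cond_Z\<close> and at the root by the zero prehistory; by \<open>cond_C\<close> the
  value of \<open>v\<close> at the start of a child edge is its value at the end of the parent, and
  \<open>sum_V\<close> collects these by vertex.\<close>

lemma B_eq_flux_jump:
  assumes y: "in_W21_Ttau m T \<tau> y" "cond_C m k T y" and v: "admissible m d k T \<tau> (\<lambda>t. 0) v"
    and W: "\<And>j. j \<in> {1..m} \<Longrightarrow> wderiv 0 (L j) (W j) (H y j)"
    and N: "\<And>j. j \<in> {1..m} \<Longrightarrow> negligible {t\<in>{0..L j}. E y j t \<noteq> W j t}"
  shows "B y v = (\<Sum>j=1..d. v j (T j) * flux_jump W j)"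
proof -
  have vW: "in_W21_Ttau m T \<tau> v" and vC: "cond_C m k T v" and vI: "cond_I \<tau> (\<lambda>t. 0) v" and vZ: "cond_Z m d T \<tau> v"
    using v by (auto simp: admissible_def)
  have 1: "integral {0..L j} (\<lambda>t. E y j t * deriv (v j) t + H y j t * v j t) = W j (L j) * v j (L j) - W j 0 * v j 0"
    if j: "j \<in> {1..m}" for j
  proof -
    have "wderiv 0 (L j) (v j) (deriv (v j))"
      using L_bounds[OF j] by (intro wderiv_subinterval[OF wderiv_edge[OF vW j]]) auto
    from wderiv_parts[OF W[OF j] this]
    have "((\<lambda>t. E y j t * deriv (v j) t + H y j t * v j t) has_integral W j (L j) * v j (L j) - W j 0 * v j 0) {0..L j}"
      by (rule has_integral_spike[OF N[OF j], rotated]) auto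
    then show ?thesis by (rule integral_unique)
  qed
  have split_m: "{1..m} = {1..d} \<union> {d+1..m}" "{1..m} = insert 1 {2..m}" using m_ge by auto
  have "(\<Sum>j\<in>{1..m}. W j (L j) * v j (L j)) = (\<Sum>j\<in>{1..d}. v j (T j) * W j (T j))"
  proof -
    have "(\<Sum>j\<in>{d+1..m}. W j (L j) * v j (L j)) = 0"
      using vZ \<tau>_ge by (intro sum.neutral) (auto simp: cond_Z_def lens_def)
    then show ?thesis unfolding split_m(1) 
      by (subst sum.union_disjoint) (auto simp: lens_def mult.commute)
  qed
  moreover have "(\<Sum>j\<in>{1..m}. W j 0 * v j 0) = (\<Sum>j\<in>{1..d}. v j (T j) * (\<Sum>\<nu>\<in>V j. W \<nu> 0))"
  proof -
    have "v 1 0 = 0" using vI \<tau>_ge by (auto simp: cond_I_def)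
    then have "(\<Sum>j\<in>{1..m}. W j 0 * v j 0) = (\<Sum>j\<in>{2..m}. W j 0 * v j 0)" unfolding split_m(2) by simp
    also have "\<dots> = (\<Sum>j\<in>{2..m}. v (k j) (T (k j)) * W j 0)"
      using vC by (intro sum.cong) (auto simp: cond_C_def)
    also have "\<dots> = (\<Sum>j\<in>{1..d}. \<Sum>\<nu>\<in>V j. v (k \<nu>) (T (k \<nu>)) * W \<nu> 0)" by (rule sum_V[symmetric])
    also have "\<dots> = (\<Sum>j\<in>{1..d}. v j (T j) * (\<Sum>\<nu>\<in>V j. W \<nu> 0))"
      unfolding sum_distrib_left by (intro sum.cong refl) (auto simp: Vset_def)
    finally show ?thesis .
  qed
  moreover have "B y v = (\<Sum>j\<in>{1..m}. W j (L j) * v j (L j) - W j 0 * v j 0)"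
    unfolding B_eq[OF y v] by (intro sum.cong refl 1)
  ultimately show ?thesis
    by (simp add: sum_subtractf flux_jump_def right_diff_distrib)
qed

text \<open>Every one-sided derivative is replaced by \<open>W - b y - c D y\<close>. At the vertex
  all edges involved share the value \<open>y j (T j)\<close> and the delayed value
  \<open>y j (T j - \<tau>)\<close>, so the zeroth-order terms cancel and only \<open>W\<close>
  survives.\<close>

lemma kirchhoff_eq_flux_jump:
  assumes yC: "cond_C m k T y" and j: "j \<in> {1..d}"
    and der: "\<And>i t. i \<in> {1..m} \<Longrightarrow> t \<in> {0..L i} \<Longrightarrow>
      (y i has_real_derivative W i t - b i * y i t - c i * D y i t) (at t within {0..L i})"
  shows "vector_derivative (y j) (at (T j) within {0..T j})
        - (\<Sum>\<nu>\<in>V j. vector_derivative (y \<nu>) (at 0 within {0..T \<nu>}))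
        + (b j - (\<Sum>\<nu>\<in>V j. b \<nu>)) * y j (T j)
        + (c j - (\<Sum>\<nu>\<in>V j. c \<nu>)) * y j (T j - \<tau>) = flux_jump W j"
proof -
  have jm: "j \<in> {1..m}" using j m_ge by auto
  have "(y j has_vector_derivative W j (T j) - b j * y j (T j) - c j * D y j (T j)) (at (T j) within {0..T j})"
    using der[OF jm, of "T j"] j T_pos[OF jm] by (simp add: lens_def has_real_derivative_iff_has_vector_derivative)
  then have 1: "vector_derivative (y j) (at (T j) within {0..T j}) = W j (T j) - b j * y j (T j) - c j * D y j (T j)"
    using T_pos[OF jm] by (intro vector_derivative_within_closed_interval) auto
  have 2: "D y j (T j) = y j (T j - \<tau>)" using \<tau>_less[OF jm] by (simp add: ydel_def)
  have 3: "vector_derivative (y \<nu>) (at 0 within {0..T \<nu>}) = W \<nu> 0 - b \<nu> * y j (T j) - c \<nu> * y j (T j - \<tau>)"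
    if \<nu>: "\<nu> \<in> V j" for \<nu>
  proof -
    have \<nu>': "\<nu> \<in> {2..m}" "\<nu> \<in> {1..m}" "k \<nu> = j" using V_mem[OF \<nu>] j by auto
    \<comment> \<open>The derivative formula lives on \<open>{0..L \<nu>}\<close> and the condition
      on \<open>{0..T \<nu>}\<close>; both give the right-hand limit at 0.\<close>
    have "at 0 within {0..L \<nu>} = at 0 within {0..T \<nu>}"
      using L_bounds[OF \<nu>'(2)] T_pos[OF \<nu>'(2)] by (simp add: at_within_Icc_at_right)
    then have "(y \<nu> has_vector_derivative W \<nu> 0 - b \<nu> * y \<nu> 0 - c \<nu> * D y \<nu> 0) (at 0 within {0..T \<nu>})"
      using der[OF \<nu>'(2), of 0] L_bounds[OF \<nu>'(2)] by (simp add: has_real_derivative_iff_has_vector_derivative)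
    moreover have C: "y \<nu> 0 = y j (T j)" using yC \<nu>' by (auto simp: cond_C_def)
    \<comment> \<open>For \<open>\<tau> = 0\<close> the value is read on the child edge instead of
      the parent, and \<open>C\<close> gives the same result.\<close>
    moreover have "D y \<nu> 0 = y j (T j - \<tau>)" using \<nu>' C \<tau>_ge by (auto simp: ydel_def)
    ultimately show ?thesis
      using T_pos[OF \<nu>'(2)] by (intro vector_derivative_within_closed_interval) auto
  qed
  have "(\<Sum>\<nu>\<in>V j. vector_derivative (y \<nu>) (at 0 within {0..T \<nu>})) =
     (\<Sum>\<nu>\<in>V j. W \<nu> 0) - (\<Sum>\<nu>\<in>V j. b \<nu>) * y j (T j) - (\<Sum>\<nu>\<in>V j. c \<nu>) * y j (T j - \<tau>)"
    by (simp add: 3 sum_subtractf sum_distrib_right)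
  then show ?thesis by (simp add: 1 2 flux_jump_def algebra_simps)
qed

section \<open>First variation and admissible increments\<close>

lemma admissible_add_cmult:
  assumes "admissible m d k T \<tau> \<phi> y" "admissible m d k T \<tau> \<psi> v"
  shows "admissible m d k T \<tau> (\<lambda>t. \<phi> t + s * \<psi> t) (\<lambda>i t. y i t + s * v i t)"
  using assms by (auto simp: admissible_def in_W21_Ttau_def cond_C_def cond_I_def cond_Z_def intro!: W21_on_add W21_on_cmult)

text \<open>For a square that is not integrable the claim rests on the default value 0 of
  \<open>integral\<close>.\<close>

lemma J_nonneg: "0 \<le> J y"
  unfolding Jfun_def
  by (intro sum_nonneg) (metis Henstock_Kurzweil_Integration.integral_nonneg not_integrable_integral order_refl zero_le_power2)

text \<open>Along a line \<open>y + s v\<close> the cost is a quadratic polynomial in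
  \<open>s\<close>, minimal at 0 only if its linear term vanishes. Conversely, a vanishing first
  variation gives \<open>J z = J y + J (z - y)\<close>.\<close>

lemma solves_VP_iff:
  assumes y: "admissible m d k T \<tau> \<phi> y"
  shows "solves_VP m d k T \<tau> b c \<phi> y \<longleftrightarrow> (\<forall>v. admissible m d k T \<tau> (\<lambda>t. 0) v \<longrightarrow> B y v = 0)"
proof (intro iffI allI impI)
  fix v assume VP: "solves_VP m d k T \<tau> b c \<phi> y" and v: "admissible m d k T \<tau> (\<lambda>t. 0) v"
  have ge: "0 \<le> 2 * s * B y v + s\<^sup>2 * J v" for s
  proof -
    have "admissible m d k T \<tau> \<phi> (\<lambda>i t. y i t + s * v i t)"
      using admissible_add_cmult[OF y v, of s] by simp
    then have "J y \<le> J (\<lambda>i t. y i t + s * v i t)" using VP by (auto simp: solves_VP_def)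
    also have "\<dots> = J y + 2 * s * B y v + s\<^sup>2 * J v"
      using y v by (intro J_expand) (auto simp: admissible_def)
    finally show ?thesis by simp
  qed
  \<comment> \<open>The test value is \<open>s = - B y v / q\<close>; taking \<open>J v + 1\<close>
    instead of \<open>J v\<close> avoids division by zero and still makes \<open>J v - 2 * q\<close>
    negative.\<close>
  define q where "q = J v + 1"
  have q: "q > 0" using J_nonneg[of v] by (simp add: q_def)
  have "2 * (- (B y v / q)) * B y v + (- (B y v / q))\<^sup>2 * J v = (B y v)\<^sup>2 / q\<^sup>2 * (J v - 2 * q)"
    using q by (simp add: field_simps power2_eq_square)
  then have "0 \<le> (B y v)\<^sup>2 / q\<^sup>2 * (J v - 2 * q)" using ge[of "- (B y v / q)"] by simp
  moreover have "J v - 2 * q < 0" using q by (simp add: q_def)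
  ultimately have "(B y v)\<^sup>2 / q\<^sup>2 \<le> 0" by (metis mult_pos_neg not_le)
  then show "B y v = 0" using q by (simp add: divide_le_0_iff)
next
  assume B0: "\<forall>v. admissible m d k T \<tau> (\<lambda>t. 0) v \<longrightarrow> B y v = 0"
  have "J y \<le> J z" if z: "admissible m d k T \<tau> \<phi> z" for z
  proof -
    have v: "admissible m d k T \<tau> (\<lambda>t. 0) (\<lambda>i t. z i t + (-1) * y i t)"
      using admissible_add_cmult[OF z y, of "-1"] by simp
    have "J (\<lambda>i t. y i t + 1 * (z i t + (-1) * y i t)) = J y + 2 * 1 * B y (\<lambda>i t. z i t + (-1) * y i t)
        + 1\<^sup>2 * J (\<lambda>i t. z i t + (-1) * y i t)"
      using y v by (intro J_expand) (auto simp: admissible_def)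
    then have "J z = J y + J (\<lambda>i t. z i t + (-1) * y i t)" using B0 v by simp
    then show ?thesis using J_nonneg[of "\<lambda>i t. z i t + (-1) * y i t"] by linarith
  qed
  then show "solves_VP m d k T \<tau> b c \<phi> y" using y by (auto simp: solves_VP_def)
qed

text \<open>Increments living on one edge. The inner cut-off supplies the zero prehistory when
  \<open>j = 1\<close>, and the outer one the zero target values beyond \<open>L j\<close>.\<close>

lemma admissible_edge:
  assumes j: "j \<in> {1..m}" and v: "W21_on 0 (L j) v" "v 0 = 0" "v (L j) = 0"
  shows "admissible m d k T \<tau> (\<lambda>t. 0)
    (\<lambda>i. if i = j then (\<lambda>t. if t \<le> L j then (if t \<le> 0 then 0 else v t) else 0) else (\<lambda>t. 0))"
    (is "admissible _ _ _ _ _ _ ?v")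
proof -
  note L = L_bounds[OF j]
  have ext: "W21_on a (T j) (\<lambda>t. if t \<le> L j then (if t \<le> 0 then 0 else v t) else 0)" if "a \<le> 0" for a
    using L v that by (intro W21_on_extend_right W21_on_extend_left) auto
  have z: "?v i 0 = 0" "?v i (T i) = 0" for i using v L by auto
  show ?thesis
    unfolding admissible_def
  proof (intro conjI)
    show "in_W21_Ttau m T \<tau> ?v"
      unfolding in_W21_Ttau_def
    proof (intro conjI ballI)
      show "W21_on (-\<tau>) (T 1) (?v 1)"
        using ext[of "-\<tau>"] W21_on_0[of "-\<tau>" "T 1"] \<tau>_ge T_pos[of 1] m_ge by (cases "j = 1") auto
      show "W21_on 0 (T i) (?v i)" if "i \<in> {2..m}" for i
        using ext[of 0] W21_on_0[of 0 "T i"] T_pos[of i] that by (cases "i = j") auto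
    qed
    show "cond_C m k T ?v" unfolding cond_C_def using z by metis
    show "cond_I \<tau> (\<lambda>t. 0) ?v" using L by (auto simp: cond_I_def)
    show "cond_Z m d T \<tau> ?v" using v by (auto simp: cond_Z_def lens_def)
  qed
qed

text \<open>A hat function at an internal vertex: it rises from 0 to 1 along edge \<open>j\<close>
  and descends along each child edge. The descent ends at \<open>L i\<close>, not
  \<open>T i\<close>, so that the target condition holds on boundary edges.\<close>

lemma admissible_vertex:
  assumes j: "j \<in> {1..d}"
  shows "admissible m d k T \<tau> (\<lambda>t. 0)
    (\<lambda>i. if i = j then (\<lambda>t. if t \<le> 0 then 0 else t / T j)
      else if i \<in> V j then (\<lambda>t. if t \<le> L i then 1 - t / L i else 0) else (\<lambda>t. 0))"
    (is "admissible _ _ _ _ _ _ ?v")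
proof -
  have jm: "j \<in> {1..m}" using j m_ge by auto
  have up: "W21_on a (T j) (\<lambda>t. if t \<le> 0 then 0 else t / T j)" if "a \<le> 0" for a
  proof (rule W21_on_extend_left)
    show "W21_on 0 (T j) (\<lambda>t. t / T j)"
      using wderiv_cmult[OF wderiv_ident[of 0 "T j"], of "1 / T j"] T_pos[OF jm] by (auto simp: W21_on_iff_wderiv)
  qed (use that in auto)
  have down: "W21_on 0 (T i) (\<lambda>t. if t \<le> L i then 1 - t / L i else 0)" if i: "i \<in> {1..m}" for i
  proof (rule W21_on_extend_right)
    show "W21_on 0 (L i) (\<lambda>t. 1 - t / L i)"
      using wderiv_diff[OF wderiv_const wderiv_cmult[OF wderiv_ident[of 0 "L i"], of "1 / L i"], of 1] L_bounds[OF i]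
      by (auto simp: W21_on_iff_wderiv)
  qed (use L_bounds[OF i] in auto)
  have V2: "i \<in> {2..m}" "k i = j" if "i \<in> V j" for i using V_mem[OF that] j by auto
  have end0: "?v i (T i) = 0" if "i \<noteq> j" "i \<in> {1..m}" for i
    using L_bounds[OF that(2)] that by auto
  show ?thesis
    unfolding admissible_def
  proof (intro conjI)
    show "in_W21_Ttau m T \<tau> ?v"
      unfolding in_W21_Ttau_def
    proof (intro conjI ballI)
      show "W21_on (-\<tau>) (T 1) (?v 1)"
        using up[of "-\<tau>"] W21_on_0[of "-\<tau>" "T 1"] \<tau>_ge T_pos[of 1] m_ge V2[of 1] by (cases "j = 1") auto
      show "W21_on 0 (T i) (?v i)" if "i \<in> {2..m}" for i
        using up[of 0] W21_on_0[of 0 "T i"] T_pos[of i] down[of i] that by (cases "i = j") auto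
    qed
    show "cond_C m k T ?v"
      unfolding cond_C_def
    proof
      fix i assume i: "i \<in> {2..m}"
      then have im: "i \<in> {1..m}" and km: "k i \<in> {1..m}" using k_mem[OF i] m_ge by auto
      have pos: "0 < T j" "0 < L i" using T_pos[OF jm] L_bounds[OF im] by auto
      show "?v i 0 = ?v (k i) (T (k i))"
      proof (cases "k i = j")
        case True
        then have "i \<in> V j" "i \<noteq> j" using im k_neq[OF im] by (auto simp: Vset_def)
        then show ?thesis using True pos by simp
      next
        case False
        then have "i \<notin> V j" by (auto simp: Vset_def)
        then have "?v i 0 = 0" by auto
        then show ?thesis using end0[OF False km] by simp
      qed
    qed
    show "cond_I \<tau> (\<lambda>t. 0) ?v" using V2[of 1] by (auto simp: cond_I_def)
    show "cond_Z m d T \<tau> ?v"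
      unfolding cond_Z_def
    proof (intro ballI)
      fix i t assume i: "i \<in> {d+1..m}" and t: "t \<in> {T i - \<tau>..T i}"
      then have "L i = T i - \<tau>" "i \<noteq> j" "0 < L i" using L_bounds(1)[of i] j by (auto simp: lens_def)
      then show "?v i t = 0" using t by auto
    qed
  qed
qed

text \<open>Increments supported on edge \<open>j\<close> are arbitrary functions vanishing at both
  ends of \<open>{0..L j}\<close>, and for them \<open>B_eq\<close> has a single summand; this is
  the hypothesis of the du Bois-Reymond lemma.\<close>

lemma VP_imp_weak_Euler_Lagrange:
  assumes y: "in_W21_Ttau m T \<tau> y" "cond_C m k T y" and j: "j \<in> {1..m}"
    and B0: "\<And>v. admissible m d k T \<tau> (\<lambda>t. 0) v \<Longrightarrow> B y v = 0"
  shows "\<exists>W. wderiv 0 (L j) W (H y j) \<and> negligible {t\<in>{0..L j}. E y j t \<noteq> W t}"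
proof -
  note L = L_bounds[OF j]
  have "integral {0..L j} (\<lambda>t. E y j t * v' t + H y j t * v t) = 0"
    if v: "wderiv 0 (L j) v v'" "v 0 = 0" "v (L j) = 0" for v v'
  proof -
    define u where "u = (\<lambda>i. if i = j then (\<lambda>t. if t \<le> L j then (if t \<le> 0 then 0 else v t) else 0) else (\<lambda>t. 0::real))"
    have u: "admissible m d k T \<tau> (\<lambda>t. 0) u"
      unfolding u_def using v by (intro admissible_edge[OF j]) (auto simp: W21_on_iff_wderiv)
    have "integral {0..L i} (\<lambda>t. E y i t * deriv (u i) t + H y i t * u i t) = 0" if "i \<noteq> j" for i
      using that by (simp add: u_def)
    then have "(\<Sum>i=1..m. integral {0..L i} (\<lambda>t. E y i t * deriv (u i) t + H y i t * u i t)) =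
       integral {0..L j} (\<lambda>t. E y j t * deriv (u j) t + H y j t * u j t)"
      using j by (subst sum.remove[of _ j]) (auto intro: sum.neutral)
    also have "\<dots> = integral {0..L j} (\<lambda>t. E y j t * v' t + H y j t * v t)"
    \<comment> \<open>The given weak derivative \<open>v'\<close> agrees with
      \<open>deriv (u j)\<close> only off a null set, and the cut-offs in \<open>u\<close> may spoil
      \<open>deriv\<close> at 0 and \<open>L j\<close>.\<close>
    proof (rule integral_spike)
      show "negligible ({t\<in>{0<..<L j}. \<not> (v differentiable at t \<and> deriv v t = v' t)} \<union> {0, L j})"
        using wderiv_deriv_negligible[OF v(1)] by (intro negligible_Un) auto
      fix t assume t: "t \<in> {0..L j} - ({t\<in>{0<..<L j}. \<not> (v differentiable at t \<and> deriv v t = v' t)} \<union> {0, L j})"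
      then have t': "t \<in> {0<..<L j}" "deriv v t = v' t" by auto
      have "deriv (u j) t = deriv v t"
        by (rule deriv_eq_on_open_interval[OF _ t'(1)]) (auto simp: u_def)
      then show "E y j t * v' t + H y j t * v t = E y j t * deriv (u j) t + H y j t * u j t"
        using t' by (simp add: u_def)
    qed
    finally show ?thesis using B0[OF u] B_eq[OF y u] by simp
  qed
  then obtain C where C: "negligible {t\<in>{0..L j}. E y j t \<noteq> C + integral {0..t} (H y j)}"
    using du_Bois_Reymond[of "L j" "E y j" "H y j"] L L2_H[OF y j] L2_on_subinterval[OF L2_ell[OF y j], of 0 "L j"] by auto
  have "wderiv 0 (L j) (\<lambda>t. C + integral {0..t} (H y j)) (\<lambda>t. 0 + H y j t)"
    using L by (intro wderiv_add wderiv_const wderiv_integral L2_H[OF y j]) auto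
  then show ?thesis using C by auto
qed

lemma solves_VP_iff_solves_B:
  "solves_VP m d k T \<tau> b c \<phi> y \<longleftrightarrow> solves_B m d k T \<tau> b c \<phi> y"
proof (cases "admissible m d k T \<tau> \<phi> y")
  case False
  then show ?thesis by (auto simp: solves_VP_def solves_B_def)
next
  case adm: True
  then have y: "in_W21_Ttau m T \<tau> y" "cond_C m k T y" by (auto simp: admissible_def)
  have dm: "j \<in> {1..m}" if "j \<in> {1..d}" for j using that m_ge by auto
  show ?thesis
  proof
    assume "solves_VP m d k T \<tau> b c \<phi> y"
    then have B0: "B y v = 0" if "admissible m d k T \<tau> (\<lambda>t. 0) v" for v
      using solves_VP_iff[OF adm] that by blast
    obtain W where W: "\<And>j. j \<in> {1..m} \<Longrightarrow> wderiv 0 (L j) (W j) (H y j)"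
      "\<And>j. j \<in> {1..m} \<Longrightarrow> negligible {t\<in>{0..L j}. E y j t \<noteq> W j t}"
    proof -
      have "\<forall>j\<in>{1..m}. \<exists>W. wderiv 0 (L j) W (H y j) \<and> negligible {t\<in>{0..L j}. E y j t \<noteq> W t}"
        by (intro ballI VP_imp_weak_Euler_Lagrange y B0)
      then show ?thesis using that by (elim bchoice[THEN exE]) blast
    qed
    note reg = Euler_Lagrange_regularity[OF y _ W]
    have "flux_jump W j = 0" if j: "j \<in> {1..d}" for j
    proof -
      define v where "v = (\<lambda>i. if i = j then (\<lambda>t. if t \<le> 0 then 0 else t / T j)
        else if i \<in> V j then (\<lambda>t. if t \<le> L i then 1 - t / L i else 0) else (\<lambda>t. 0::real))"
      have v: "admissible m d k T \<tau> (\<lambda>t. 0) v" unfolding v_def by (rule admissible_vertex[OF j])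
      \<comment> \<open>The hat is 1 at vertex \<open>j\<close> and 0 at every other internal
        vertex, so it isolates one flux jump.\<close>
      have "v i (T i) = (if i = j then 1 else 0)" if "i \<in> {1..d}" for i
        using L_bounds[OF dm[OF that]] T_pos[OF dm[OF that]] by (auto simp: v_def)
      then have "(\<Sum>i=1..d. v i (T i) * flux_jump W i) = (\<Sum>i=1..d. if i = j then flux_jump W i else 0)"
        by (intro sum.cong) auto
      also have "\<dots> = flux_jump W j" using j by simp
      finally show ?thesis using B_eq_flux_jump[OF y v W] B0[OF v] by simp
    qed
    then show "solves_B m d k T \<tau> b c \<phi> y"
      unfolding solves_B_def in_W22_tilde_def AE_interval_iff_negligible
      using adm reg(1,3) kirchhoff_eq_flux_jump[OF y(2) _ reg(2)] by auto
  next
    assume SB: "solves_B m d k T \<tau> b c \<phi> y"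
    then have "\<forall>j\<in>{1..m}. \<exists>W. wderiv 0 (L j) W (H y j) \<and> negligible {t\<in>{0..L j}. E y j t \<noteq> W t}"
      unfolding solves_B_def in_W22_tilde_def AE_interval_iff_negligible
      using Euler_Lagrange_weak[OF y] by auto
    then obtain W where W: "\<And>j. j \<in> {1..m} \<Longrightarrow> wderiv 0 (L j) (W j) (H y j)"
      "\<And>j. j \<in> {1..m} \<Longrightarrow> negligible {t\<in>{0..L j}. E y j t \<noteq> W j t}"
      by (elim bchoice[THEN exE]) blast
    \<comment> \<open>The representative \<open>W\<close> just obtained is fed back into the
      regularity lemma for its one-sided derivative formula, which translates the Kirchhoff
      conditions into vanishing jumps.\<close>
    note reg = Euler_Lagrange_regularity[OF y _ W]
    have "flux_jump W j = 0" if j: "j \<in> {1..d}" for j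
      using kirchhoff_eq_flux_jump[OF y(2) j reg(2)] SB j by (auto simp: solves_B_def)
    then show "solves_VP m d k T \<tau> b c \<phi> y"
      using solves_VP_iff[OF adm] B_eq_flux_jump[OF y _ W] by simp
  qed
qed

end

theorem theorem1:
  fixes m d :: nat and k :: "nat \<Rightarrow> nat" and T :: "nat \<Rightarrow> real" and \<tau> :: real
    and b c :: "nat \<Rightarrow> real" and \<phi> :: "real \<Rightarrow> real" and y :: "nat \<Rightarrow> real \<Rightarrow> real"
  assumes "tree_setup m d k T \<tau>"
    and "W21_on (-\<tau>) 0 \<phi>"
    and "in_W21_Ttau m T \<tau> y"
  shows "solves_VP m d k T \<tau> b c \<phi> y \<longleftrightarrow>
         (in_W22_tilde m d T \<tau> y \<and> solves_B m d k T \<tau> b c \<phi> y)"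
proof -
  interpret delayed_tree m d k T \<tau> b c by unfold_locales (rule assms(1))
  show ?thesis using solves_VP_iff_solves_B[of \<phi> y] by (auto simp: solves_B_def)
qed

end
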